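(* Let $\Omega$ be a real Hilbert space, fix $x\in\mathbb{R}$, and let $(X_1,Y_1),\dots,(X_n,Y_n)$ be an i.i.d. sample from the model $Y=m_\oplus(X)+\sigma(X)\varepsilon$ described in the context. Assume that, for some neighborhood $N_x$ of $x$: (N1) $X$ has a density $f$ which is continuous and positive on $N_x$; (N2) the kernel $K$ is a symmetric probability density function with bounded support, and $\int u^2K(u)\,du$ and $\int K^2(u)\,du$ are finite; (N3) $h=h_n>0$ satisfies $h\to0$, $nh\to\infty$ and $nh^5\to0$ as $n\to\infty$; (O1) for all $\omega\in\Omega$, the function $\langle m_\oplus(\cdot),\omega\rangle_\Omega$ is twice continuously differentiable on $N_x$; (O2) for all $\omega\in\Omega\setminus\{0\}$, the function $\sigma^2(\cdot)\,\mathrm{E}[\langle\varepsilon,\omega\rangle_\Omega^2]$ is continuous and positive on $N_x$; (O3) for all $\omega\in\Omega$, the function $\mathrm{E}[\langle Y,\omega\rangle_\Omega^4\mid X=\cdot\,]$ is bounded on $N_x$. Then for every $\omega\in\Omega$, as $n\to\infty$, $$\sqrt{nh}\left\{\left\langle \hat l_\oplus(x)-m_\oplus(x),\omega\right\rangle_\Omega-\left(\frac{\int u^2K(u)\,du}{2}\cdot\frac{\partial^2}{\partial x^2}\langle m_\oplus(x),\omega\rangle_\Omega\right)h^2\right\}\leadsto\mathcal{N}\left(0,\ \frac{\int K^2(u)\,du}{f(x)}\,\sigma^2(x)\,\mathrm{E}[\langle\varepsilon,\omega\rangle_\Omega^2]\right).$$ In particular, taking $\omega=m_\oplus(x)$,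 $$\sqrt{nh}\left\{\left\langle \hat l_\oplus(x),m_\oplus(x)\right\rangle_\Omega-\|m_\oplus(x)\|_\Omega^2-\left(\frac{\int u^2K(u)\,du}{2}\cdot\left.\frac{\partial^2}{\partial x^2}\langle m_\oplus(x),\omega\rangle_\Omega\right|_{\omega=m_\oplus(x)}\right)h^2\right\}\leadsto\mathcal{N}\left(0,\ \frac{\int K^2(u)\,du}{f(x)}\,\sigma^2(x)\,\mathrm{E}[\langle\varepsilon,m_\oplus(x)\rangle_\Omega^2]\right),$$ where the second derivative is taken with $\omega$ held fixed and then evaluated at $\omega=m_\oplus(x)$.
   Context: $\leadsto$ denotes weak convergence; $\mathcal{N}(0,0)$ is the point mass at $0$. Model: $X$ is a real random variable with finite mean and positive finite variance; $Y$ is an $\Omega$-valued random element with $\mathrm{E}\|Y\|_\Omega^2<\infty$; $Y=m_\oplus(X)+\sigma(X)\varepsilon$, where $m_\oplus:\mathbb{R}\to\Omega$, $\varepsilon$ is an $\Omega$-valued random element independent of $X$ with $\mathrm{E}[\langle\varepsilon,\omega\rangle_\Omega]=0$ for all $\omega\in\Omega$ and $\mathrm{E}[\|\varepsilon\|_\Omega^2]=1$, and $\sigma\ge 0$ with $\sigma^2(x)=\mathrm{E}[\|Y-m_\oplus(x)\|_\Omega^2\mid X=x]$. Estimator: for a kernel $K$ and bandwidth $h>0$ put $K_h(\cdot)=h^{-1}K(\cdot/h)$, $\hat\mu_j=\frac1n\sum_{i=1}^nK_h(X_i-x)(X_i-x)^j$ for $j=0,1,2$, $\hat\sigma_0^2=\hat\mu_0\hat\mu_2-\hat\mu_1^2$,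 and $$s_{in}(x,h)=\frac{1}{\hat\sigma_0^2}K_h(X_i-x)\left[\hat\mu_2-\hat\mu_1(X_i-x)\right]$$ (on the event $\hat\sigma_0^2>0$; the value elsewhere is irrelevant for the asymptotic statement). The local Fréchet regression estimator is $$\hat l_\oplus(x)=\arg\min_{\omega\in\Omega}\frac1n\sum_{i=1}^ns_{in}(x,h)\|Y_i-\omega\|_\Omega^2,$$ which in a Hilbert space equals $\frac1n\sum_{i=1}^ns_{in}(x,h)Y_i$. *)

theory Defs
  imports "HOL-Probability.Probability"
begin

definition scaled_kernel :: "(real \<Rightarrow> real) \<Rightarrow> real \<Rightarrow> real \<Rightarrow> real" where
  "scaled_kernel K h u = K (u / h) / h"

text \<open>Samples are 0-based: \<open>xs 0, \<dots>, xs (n - 1)\<close>.\<close>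

definition mu_hat ::
  "(real \<Rightarrow> real) \<Rightarrow> real \<Rightarrow> real \<Rightarrow> nat \<Rightarrow> (nat \<Rightarrow> real) \<Rightarrow> nat \<Rightarrow> real" where
  "mu_hat K h x n xs j =
     (\<Sum>i<n. scaled_kernel K h (xs i - x) * (xs i - x) ^ j) / real n"

definition sigma0_sq_hat ::
  "(real \<Rightarrow> real) \<Rightarrow> real \<Rightarrow> real \<Rightarrow> nat \<Rightarrow> (nat \<Rightarrow> real) \<Rightarrow> real" where
  "sigma0_sq_hat K h x n xs =
     mu_hat K h x n xs 0 * mu_hat K h x n xs 2 - (mu_hat K h x n xs 1)\<^sup>2"

text \<open>If \<^term>\<open>sigma0_sq_hat K h x n xs = 0\<close> all weights are \<open>0\<close> (division by zero).\<close>

definition ll_weight ::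
  "(real \<Rightarrow> real) \<Rightarrow> real \<Rightarrow> real \<Rightarrow> nat \<Rightarrow> (nat \<Rightarrow> real) \<Rightarrow> nat \<Rightarrow> real" where
  "ll_weight K h x n xs i =
     1 / sigma0_sq_hat K h x n xs * scaled_kernel K h (xs i - x)
       * (mu_hat K h x n xs 2 - mu_hat K h x n xs 1 * (xs i - x))"

text \<open>The minimiser exists and is unique when \<^term>\<open>sigma0_sq_hat K h x n xs > 0\<close>; see
  \<open>local_frechet_eq\<close> below. If \<^term>\<open>sigma0_sq_hat K h x n xs = 0\<close>, the objective vanishes
  identically and \<^const>\<open>arg_min\<close> returns some element that does not depend on the data.\<close>

definition local_frechet ::
  "(real \<Rightarrow> real) \<Rightarrow> real \<Rightarrow> real \<Rightarrow> nat \<Rightarrow> (nat \<Rightarrow> real) \<Rightarrow> (nat \<Rightarrow> 'a::real_inner) \<Rightarrow> 'a" where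
  "local_frechet K h x n xs ys =
     (ARG_MIN (\<lambda>w. (\<Sum>i<n. ll_weight K h x n xs i * (norm (ys i - w))\<^sup>2) / real n) w. True)"

text \<open>\<open>g\<close> is a version of \<open>t \<mapsto> E[Z | X = t]\<close> for \<open>Z \<ge> 0\<close>; no integrability of \<open>Z\<close> is required,
  so \<open>g\<close> may take the value \<open>\<infinity>\<close>.\<close>

definition cond_exp_given ::
  "'b measure \<Rightarrow> ('b \<Rightarrow> real) \<Rightarrow> ('b \<Rightarrow> real) \<Rightarrow> (real \<Rightarrow> ennreal) \<Rightarrow> bool" where
  "cond_exp_given P X Z g \<longleftrightarrow>
     g \<in> borel_measurable borel \<and>
     (AE s in P. nn_cond_exp P (vimage_algebra (space P) X borel) (\<lambda>s. ennreal (Z s)) s = g (X s))"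

text \<open>Normal law with mean \<open>\<mu>\<close> and variance \<open>v \<ge> 0\<close>; the library density
  \<^const>\<open>normal_density\<close> takes the standard deviation and degenerates at \<open>0\<close>.\<close>

definition normal_law :: "real \<Rightarrow> real \<Rightarrow> real measure" where
  "normal_law \<mu> v =
     (if v = 0 then return borel \<mu>
      else density lborel (\<lambda>t. ennreal (normal_density \<mu> (sqrt v) t)))"

lemma ll_weight_sum:
  assumes "sigma0_sq_hat K h x n xs > 0"
  shows "(\<Sum>i<n. ll_weight K h x n xs i) / real n = 1"
proof -
  let ?k = "\<lambda>i. scaled_kernel K h (xs i - x)"
  let ?S = "sigma0_sq_hat K h x n xs"
  let ?m = "mu_hat K h x n xs"
  have "(\<Sum>i<n. ll_weight K h x n xs i)
      = (\<Sum>i<n. (?m 2 * ?k i - ?m 1 * (?k i * (xs i - x))) / ?S)"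
    by (intro sum.cong) (auto simp: ll_weight_def algebra_simps diff_divide_distrib add_divide_distrib)
  also have "\<dots> = (?m 2 * (\<Sum>i<n. ?k i) - ?m 1 * (\<Sum>i<n. ?k i * (xs i - x))) / ?S"
    by (simp add: sum_divide_distrib[symmetric] sum_subtractf sum_distrib_left)
  finally have "(\<Sum>i<n. ll_weight K h x n xs i) / real n
      = (?m 2 * ((\<Sum>i<n. ?k i) / real n) - ?m 1 * ((\<Sum>i<n. ?k i * (xs i - x)) / real n)) / ?S"
    by (simp add: diff_divide_distrib mult.commute)
  also have "\<dots> = (?m 2 * ?m 0 - ?m 1 * ?m 1) / ?S"
    by (simp add: mu_hat_def)
  also have "\<dots> = 1"
    using assms by (simp add: sigma0_sq_hat_def power2_eq_square mult.commute)
  finally show ?thesis .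
qed

lemma local_frechet_eq:
  fixes ys :: "nat \<Rightarrow> 'a::real_inner"
  assumes "sigma0_sq_hat K h x n xs > 0"
  shows "local_frechet K h x n xs ys = (\<Sum>i<n. ll_weight K h x n xs i *\<^sub>R ys i) /\<^sub>R real n"
proof -
  let ?s = "ll_weight K h x n xs"
  let ?f = "\<lambda>w. (\<Sum>i<n. ?s i * (norm (ys i - w))\<^sup>2) / real n"
  define v where "v = (\<Sum>i<n. ?s i *\<^sub>R ys i) /\<^sub>R real n"
  define C where "C = (\<Sum>i<n. ?s i * (norm (ys i))\<^sup>2) / real n"
  have f: "?f w = C - (norm v)\<^sup>2 + (norm (w - v))\<^sup>2" for w
  proof -
    have "(\<Sum>i<n. ?s i * (norm (ys i - w))\<^sup>2)
        = (\<Sum>i<n. ?s i * (norm (ys i))\<^sup>2 - 2 * ((?s i *\<^sub>R ys i) \<bullet> w) + ?s i * (norm w)\<^sup>2)"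
      by (intro sum.cong) (auto simp: power2_norm_eq_inner inner_diff inner_commute algebra_simps)
    also have "\<dots> = (\<Sum>i<n. ?s i * (norm (ys i))\<^sup>2) - 2 * ((\<Sum>i<n. ?s i *\<^sub>R ys i) \<bullet> w)
        + (\<Sum>i<n. ?s i) * (norm w)\<^sup>2"
      by (simp add: sum.distrib sum_subtractf sum_distrib_left sum_distrib_right inner_sum_left)
    finally have eq: "(\<Sum>i<n. ?s i * (norm (ys i - w))\<^sup>2)
        = (\<Sum>i<n. ?s i * (norm (ys i))\<^sup>2) - 2 * ((\<Sum>i<n. ?s i *\<^sub>R ys i) \<bullet> w)
          + (\<Sum>i<n. ?s i) * (norm w)\<^sup>2" .
    have "?f w = C - 2 * (v \<bullet> w) + ((\<Sum>i<n. ?s i) / real n) * (norm w)\<^sup>2"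
      unfolding eq C_def v_def by (simp add: divide_inverse algebra_simps)
    then show ?thesis
      unfolding ll_weight_sum[OF assms]
      by (simp add: power2_norm_eq_inner inner_diff inner_commute)
  qed
  have "is_arg_min ?f (\<lambda>_. True) (local_frechet K h x n xs ys)"
    unfolding local_frechet_def arg_min_def
    by (rule someI[of _ v]) (auto simp: is_arg_min_def f not_less)
  then have "\<not> ?f v < ?f (local_frechet K h x n xs ys)"
    by (auto simp: is_arg_min_def)
  then have "local_frechet K h x n xs ys = v"
    by (simp add: f)
  then show ?thesis by (simp add: v_def)
qed

end

theory Submission
  imports Defs "HOL-Real_Asymp.Real_Asymp"
begin

text \<open>Since \<open>n h\<^sup>5 \<rightarrow> 0\<close>, both the claimed bias and the quadratic Taylor remainder of the regression
  function are negligible at the scale \<open>sqrt (n h)\<close>. Local linear weights reproduce affine functions,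
  hence with \<open>A\<^sub>j = (1 / (n h)) (\<Sum>i<n. K d\<^sub>i d\<^sub>i ^ j)\<close>, \<open>d\<^sub>i = (X\<^sub>i - x) / h\<close>, and
  \<open>S\<^sub>j = (1 / sqrt (n h)) (\<Sum>i<n. K d\<^sub>i d\<^sub>i ^ j \<sigma> X\<^sub>i \<langle>\<epsilon>\<^sub>i, w\<rangle>)\<close> the rescaled error equals
  \<open>(A\<^sub>2 S\<^sub>0 - A\<^sub>1 S\<^sub>1) / (A\<^sub>0 A\<^sub>2 - A\<^sub>1\<^sup>2)\<close> up to \<open>o(1)\<close>. By second moments \<open>A\<^sub>1 \<rightarrow> 0\<close>,
  \<open>A\<^sub>2 / (A\<^sub>0 A\<^sub>2 - A\<^sub>1\<^sup>2) \<rightarrow> 1 / f x\<close> in probability, and \<open>S\<^sub>0\<close>, \<open>S\<^sub>1\<close> are bounded in \<open>L\<^sup>2\<close>, so only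
  \<open>S\<^sub>0 / f x\<close> survives. Its characteristic function is the \<open>n\<close>-th power of an integral over \<open>u\<close> of
  the characteristic function of \<open>\<langle>\<epsilon>, w\<rangle>\<close> at \<open>t K u \<sigma> (x + h u) / sqrt (n h)\<close>, and the second-order
  expansion of the latter at \<open>0\<close> yields the Gaussian limit by dominated convergence.\<close>

subsection \<open>Convergence in probability as convergence along a filter\<close>

text \<open>\<open>whp M\<close> is generated by the sequences of events whose probability tends to \<open>1\<close>. Convergence in
  probability is \<^const>\<open>tendsto\<close> along this filter, so it inherits the whole calculus of limits.\<close>

definition whp :: "'c measure \<Rightarrow> (nat \<times> 'c) filter" where
  "whp M = (INF E \<in> {E. range E \<subseteq> sets M \<and> (\<lambda>n. measure M (E n)) \<longlonglongrightarrow> 1}.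
     principal {(n, s). s \<in> E n})"

context prob_space
begin

text \<open>Intersecting two admissible event sequences gives a third, since
  \<open>prob (E n \<inter> F n)\<close> is at least \<open>prob (E n) + prob (F n) - 1\<close>. The
  principal filters therefore form a filter base, and a single sequence of events witnesses each
  eventual property.\<close>

lemma eventually_whp:
  "eventually Q (whp M) \<longleftrightarrow>
    (\<exists>E. range E \<subseteq> events \<and> (\<lambda>n. prob (E n)) \<longlonglongrightarrow> 1 \<and> (\<forall>n. \<forall>s\<in>E n. Q (n, s)))"
proof -
  define B where "B = {E. range E \<subseteq> events \<and> (\<lambda>n. prob (E n)) \<longlonglongrightarrow> 1}"
  define \<F> where "\<F> E = principal {(n, s). s \<in> E n}" for E :: "nat \<Rightarrow> 'a set"
  have "\<exists>G\<in>B. \<F> G \<le> inf (\<F> E) (\<F> F)" if "E \<in> B" "F \<in> B" for E F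
  proof -
    have E: "range E \<subseteq> events" "(\<lambda>n. prob (E n)) \<longlonglongrightarrow> 1"
      and F: "range F \<subseteq> events" "(\<lambda>n. prob (F n)) \<longlonglongrightarrow> 1"
      using that by (auto simp: B_def)
    have "(\<lambda>n. prob (E n \<inter> F n)) \<longlonglongrightarrow> 1"
    proof (rule tendsto_sandwich)
      show "\<forall>\<^sub>F n in sequentially. prob (E n) + prob (F n) - 1 \<le> prob (E n \<inter> F n)"
      proof (intro always_eventually allI)
        fix n
        have "prob (E n \<union> F n) = prob (E n) + prob (F n) - prob (E n \<inter> F n)"
          using E F by (intro measure_Un3) (auto simp: fmeasurable_eq_sets)
        then show "prob (E n) + prob (F n) - 1 \<le> prob (E n \<inter> F n)"
          using prob_le_1[of "E n \<union> F n"] by simp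
      qed
      show "(\<lambda>n. prob (E n) + prob (F n) - 1) \<longlonglongrightarrow> 1"
        using tendsto_diff[OF tendsto_add[OF E(2) F(2)] tendsto_const[of 1]] by simp
      show "\<forall>\<^sub>F n in sequentially. prob (E n \<inter> F n) \<le> 1"
        by simp
    qed simp
    moreover have "range (\<lambda>n. E n \<inter> F n) \<subseteq> events"
      using E F by auto
    ultimately show ?thesis
      by (intro bexI[of _ "\<lambda>n. E n \<inter> F n"]) (auto simp: B_def \<F>_def)
  qed
  moreover have "B \<noteq> {}"
    by (auto intro!: exI[of _ "\<lambda>_. space M"] simp: prob_space B_def)
  ultimately have "eventually Q (INF E\<in>B. \<F> E) \<longleftrightarrow> (\<exists>E\<in>B. eventually Q (\<F> E))"
    by (intro eventually_INF_base)
  then show ?thesis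
    by (simp add: whp_def B_def \<F>_def eventually_principal Ball_def conj_assoc)
qed

lemma eventually_whpI:
  assumes "\<And>n. {s \<in> space M. \<not> Q n s} \<in> events"
    and "(\<lambda>n. prob {s \<in> space M. \<not> Q n s}) \<longlonglongrightarrow> 0"
  shows "\<forall>\<^sub>F (n, s) in whp M. Q n s"
proof -
  have "(\<lambda>n. prob (space M - {s \<in> space M. \<not> Q n s})) = (\<lambda>n. 1 - prob {s \<in> space M. \<not> Q n s})"
    using assms(1) by (simp add: prob_compl)
  then have "(\<lambda>n. prob (space M - {s \<in> space M. \<not> Q n s})) \<longlonglongrightarrow> 1"
    using tendsto_diff[OF tendsto_const assms(2), of 1] by simp
  then show ?thesis
    unfolding eventually_whp using assms(1)
    by (intro exI[of _ "\<lambda>n. space M - {s \<in> space M. \<not> Q n s}"]) auto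
qed

lemma eventually_whpD:
  assumes "\<forall>\<^sub>F (n, s) in whp M. Q n s" "\<And>n. {s \<in> space M. \<not> Q n s} \<in> events"
  shows "(\<lambda>n. prob {s \<in> space M. \<not> Q n s}) \<longlonglongrightarrow> 0"
proof -
  obtain E where E: "range E \<subseteq> events" "(\<lambda>n. prob (E n)) \<longlonglongrightarrow> 1" "\<forall>n. \<forall>s\<in>E n. Q n s"
    using assms(1) unfolding eventually_whp by auto
  have "(\<lambda>n. prob (space M - E n)) = (\<lambda>n. 1 - prob (E n))"
    using E(1) by (auto simp: prob_compl)
  then have "(\<lambda>n. prob (space M - E n)) \<longlonglongrightarrow> 0"
    using tendsto_diff[OF tendsto_const E(2), of 1] by simp
  moreover have "prob {s \<in> space M. \<not> Q n s} \<le> prob (space M - E n)" for n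
    using E by (intro finite_measure_mono) auto
  ultimately show ?thesis
    by (intro tendsto_0_le[where K=1 and g="\<lambda>n. prob {s \<in> space M. \<not> Q n s}"]) auto
qed

text \<open>Makes deterministic limits and eventual statements in \<open>n\<close> usable along
  \<open>whp M\<close>: the witnessing events are empty before \<open>n0\<close> and the whole space
  from there on.\<close>

lemma filterlim_fst_whp: "filterlim fst sequentially (whp M)"
  unfolding filterlim_iff eventually_sequentially
proof safe
  fix Q :: "nat \<Rightarrow> bool" and n0
  assume Q: "\<forall>n\<ge>n0. Q n"
  have "(\<lambda>n. prob (if n0 \<le> n then space M else {})) \<longlonglongrightarrow> 1"
    by (rule tendsto_eventually) (auto simp: eventually_sequentially prob_space)
  then show "\<forall>\<^sub>F z in whp M. Q (fst z)"
    unfolding eventually_whp using Q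
    by (intro exI[of _ "\<lambda>n. if n0 \<le> n then space M else {}"]) (auto split: if_splits)
qed

lemma tendsto_whp_of_seq: "c \<longlonglongrightarrow> l \<Longrightarrow> ((\<lambda>(n, s). c n) \<longlongrightarrow> l) (whp M)"
  using filterlim_compose[OF _ filterlim_fst_whp, of c "nhds l"] by (simp add: case_prod_unfold)

lemma tendsto_whpI:
  fixes A :: "nat \<Rightarrow> 'a \<Rightarrow> real"
  assumes [measurable]: "\<And>n. A n \<in> borel_measurable M"
    and "\<And>e. e > 0 \<Longrightarrow> (\<lambda>n. prob {s \<in> space M. e \<le> \<bar>A n s - c\<bar>}) \<longlonglongrightarrow> 0"
  shows "((\<lambda>(n, s). A n s) \<longlongrightarrow> c) (whp M)"
proof (rule tendstoI)
  fix e :: real assume "0 < e"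
  have "\<forall>\<^sub>F (n, s) in whp M. \<not> e \<le> \<bar>A n s - c\<bar>"
    by (rule eventually_whpI) (use assms(2)[OF \<open>0 < e\<close>] in simp_all)
  then show "\<forall>\<^sub>F z in whp M. dist (case z of (n, s) \<Rightarrow> A n s) c < e"
    by (simp add: case_prod_unfold dist_real_def not_le)
qed

lemma tendsto_whpD:
  fixes A :: "nat \<Rightarrow> 'a \<Rightarrow> real"
  assumes [measurable]: "\<And>n. A n \<in> borel_measurable M"
    and "((\<lambda>(n, s). A n s) \<longlongrightarrow> c) (whp M)" "e > 0"
  shows "(\<lambda>n. prob {s \<in> space M. e \<le> \<bar>A n s - c\<bar>}) \<longlonglongrightarrow> 0"
proof -
  have "\<forall>\<^sub>F (n, s) in whp M. \<not> e \<le> \<bar>A n s - c\<bar>"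
    using tendstoD[OF assms(2,3)] by (simp add: case_prod_unfold dist_real_def not_le)
  from eventually_whpD[OF this] show ?thesis by simp
qed

text \<open>Markov's inequality for the squared deviation. Integrability is asked for large
  \<open>n\<close> only, because a density that is controlled just near \<open>x\<close> yields
  finite kernel moments only once the bandwidth is small.\<close>

lemma tendsto_whp_L2:
  fixes A :: "nat \<Rightarrow> 'a \<Rightarrow> real"
  assumes [measurable]: "\<And>n. A n \<in> borel_measurable M"
    and int: "\<forall>\<^sub>F n in sequentially. integrable M (\<lambda>s. (A n s - c)\<^sup>2)"
    and lim: "(\<lambda>n. expectation (\<lambda>s. (A n s - c)\<^sup>2)) \<longlonglongrightarrow> 0"
  shows "((\<lambda>(n, s). A n s) \<longlongrightarrow> c) (whp M)"
proof (rule tendsto_whpI)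
  fix e :: real assume e: "e > 0"
  show "(\<lambda>n. prob {s \<in> space M. e \<le> \<bar>A n s - c\<bar>}) \<longlonglongrightarrow> 0"
  proof (rule tendsto_sandwich[OF _ _ tendsto_const])
    show "\<forall>\<^sub>F n in sequentially. prob {s \<in> space M. e \<le> \<bar>A n s - c\<bar>} \<le>
        expectation (\<lambda>s. (A n s - c)\<^sup>2) / e\<^sup>2"
      using int
    proof eventually_elim
      case (elim n)
      have "prob {s \<in> space M. e \<le> \<bar>A n s - c\<bar>} = prob {s \<in> space M. (A n s - c)\<^sup>2 \<ge> e\<^sup>2}"
        using e by (intro arg_cong[where f=prob]) (auto simp: abs_le_square_iff[symmetric])
      also have "\<dots> \<le> expectation (\<lambda>s. (A n s - c)\<^sup>2) / e\<^sup>2"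
        using e elim by (intro integral_Markov_inequality_measure[where A="{}"]) auto
      finally show ?case .
    qed
    show "(\<lambda>n. expectation (\<lambda>s. (A n s - c)\<^sup>2) / e\<^sup>2) \<longlonglongrightarrow> 0"
      using tendsto_divide[OF lim tendsto_const[of "e\<^sup>2"]] e by simp
  qed auto
qed simp

text \<open>If the product is at least \<open>e\<close> in modulus, then the first factor is at
  least \<open>e / k\<close> or the second at least \<open>k\<close>. The first event is rare by
  convergence in probability, the second by Markov's inequality once \<open>k\<close> is
  large.\<close>

lemma tendsto_whp_mult_L2_bounded:
  fixes A B :: "nat \<Rightarrow> 'a \<Rightarrow> real"
  assumes [measurable]: "\<And>n. A n \<in> borel_measurable M" "\<And>n. B n \<in> borel_measurable M"
    and A: "((\<lambda>(n, s). A n s) \<longlongrightarrow> 0) (whp M)"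
    and int: "\<forall>\<^sub>F n in sequentially. integrable M (\<lambda>s. (B n s)\<^sup>2) \<and> expectation (\<lambda>s. (B n s)\<^sup>2) \<le> C"
  shows "((\<lambda>(n, s). A n s * B n s) \<longlongrightarrow> 0) (whp M)"
proof (rule tendsto_whpI)
  fix e :: real assume e: "e > 0"
  show "(\<lambda>n. prob {s \<in> space M. e \<le> \<bar>A n s * B n s - 0\<bar>}) \<longlonglongrightarrow> 0"
  proof (rule tendstoI)
    fix d :: real assume d: "d > 0"
    \<comment> \<open>\<open>C'\<close> is positive even if \<open>C\<close> is not, and
      \<open>k\<close> is the level at which Markov's bound \<open>C' / k\<^sup>2\<close> equals
      \<open>d / 2\<close>.\<close>
    define C' where "C' = \<bar>C\<bar> + 1"
    define k where "k = sqrt (2 * C' / d)"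
    have C': "C' > 0" "C \<le> C'" unfolding C'_def by auto
    have k: "k > 0" "C' / k\<^sup>2 = d / 2"
      using d C' by (auto simp: k_def)
    have "\<forall>\<^sub>F n in sequentially. dist (prob {s \<in> space M. e / k \<le> \<bar>A n s - 0\<bar>}) 0 < d / 2"
      using e k d by (intro tendstoD[OF tendsto_whpD[OF _ A]]) auto
    with int show "\<forall>\<^sub>F n in sequentially. dist (prob {s \<in> space M. e \<le> \<bar>A n s * B n s - 0\<bar>}) 0 < d"
    proof eventually_elim
      case (elim n)
      have *: "e / k \<le> \<bar>a\<bar> \<or> k\<^sup>2 \<le> b\<^sup>2" if "e \<le> \<bar>a * b\<bar>" for a b :: real
      proof (rule ccontr)
        assume "\<not> (e / k \<le> \<bar>a\<bar> \<or> k\<^sup>2 \<le> b\<^sup>2)"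
        then have *: "e \<le> \<bar>a * b\<bar>" "\<bar>a\<bar> < e / k" "\<not> k \<le> \<bar>b\<bar>"
          using that k power_mono[of k "\<bar>b\<bar>" 2] by auto
        then have "\<bar>a\<bar> * \<bar>b\<bar> \<le> \<bar>a\<bar> * k" by (intro mult_left_mono) auto
        also have "\<dots> < e" using * k by (simp add: field_simps)
        finally show False using * by (simp add: abs_mult)
      qed
      then have "prob {s \<in> space M. e \<le> \<bar>A n s * B n s - 0\<bar>} \<le>
         prob ({s \<in> space M. e / k \<le> \<bar>A n s - 0\<bar>} \<union> {s \<in> space M. (B n s)\<^sup>2 \<ge> k\<^sup>2})"
        using * by (intro finite_measure_mono) auto
      also have "\<dots> \<le> prob {s \<in> space M. e / k \<le> \<bar>A n s - 0\<bar>} + prob {s \<in> space M. (B n s)\<^sup>2 \<ge> k\<^sup>2}"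
        by (rule measure_Un_le) auto
      also have "prob {s \<in> space M. (B n s)\<^sup>2 \<ge> k\<^sup>2} \<le> expectation (\<lambda>s. (B n s)\<^sup>2) / k\<^sup>2"
        using k elim by (intro integral_Markov_inequality_measure[where A="{}"]) auto
      also have "\<dots> \<le> C' / k\<^sup>2"
        using elim C' by (intro divide_right_mono) auto
      finally show ?case
        using elim k by simp
    qed
  qed
qed simp

section \<open>Slutsky's lemma through characteristic functions\<close>

lemma norm_iexp_diff_le: "cmod (iexp a - iexp b) \<le> \<bar>a - b\<bar>"
proof -
  have "iexp a - iexp b = iexp b * (iexp (a - b) - 1)"
    by (simp add: algebra_simps flip: exp_add)
  then have "cmod (iexp a - iexp b) = cmod (iexp (a - b) - 1)"
    by (simp add: norm_mult)
  also have "\<dots> \<le> \<bar>a - b\<bar>"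
    using iexp_approx1[of "a - b" 0] by simp
  finally show ?thesis .
qed

text \<open>Where the two variables differ by less than \<open>e\<close>, the exponentials differ by
  at most \<open>\<bar>t\<bar> * e\<close>; on the remaining event, whose probability vanishes, they
  differ by at most 2.\<close>

lemma char_distr_diff_tendsto_0:
  fixes U S :: "nat \<Rightarrow> 'a \<Rightarrow> real"
  assumes [measurable]: "\<And>n. U n \<in> borel_measurable M" "\<And>n. S n \<in> borel_measurable M"
    and diff: "((\<lambda>(n, s). U n s - S n s) \<longlongrightarrow> 0) (whp M)"
  shows "(\<lambda>n. char (distr M borel (U n)) t - char (distr M borel (S n)) t) \<longlonglongrightarrow> 0"
proof (rule tendstoI)
  fix d :: real assume d: "d > 0"
  \<comment> \<open>Half of \<open>d\<close> is left for the Lipschitz part and half for the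
    exceptional event of probability below \<open>d / 4\<close>. The summand 1 covers
    \<open>t = 0\<close>.\<close>
  define e where "e = d / (2 * (\<bar>t\<bar> + 1))"
  have e: "e > 0" using d by (simp add: e_def add_nonneg_pos)
  have te: "\<bar>t\<bar> * e \<le> d / 2"
    using d by (simp add: e_def field_simps add_nonneg_pos)
  have "\<forall>\<^sub>F n in sequentially. dist (prob {s \<in> space M. e \<le> \<bar>(U n s - S n s) - 0\<bar>}) 0 < d / 4"
    using d by (intro tendstoD[OF tendsto_whpD[OF _ diff e]]) auto
  then show "\<forall>\<^sub>F n in sequentially.
      dist (char (distr M borel (U n)) t - char (distr M borel (S n)) t) 0 < d"
  proof eventually_elim
    case (elim n)
    let ?E = "{s \<in> space M. e \<le> \<bar>(U n s - S n s) - 0\<bar>}"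
    have int: "integrable M (\<lambda>s. iexp (t * U n s))" "integrable M (\<lambda>s. iexp (t * S n s))"
      by (auto intro!: integrable_const_bound[of _ 1])
    have ind: "integrable M (\<lambda>s. 2 * indicator ?E s :: real)"
      by (intro integrable_mult_right integrable_real_indicator) (auto simp: less_top[symmetric])
    have bound: "cmod (iexp (t * U n s) - iexp (t * S n s)) \<le> \<bar>t\<bar> * e + 2 * indicator ?E s"
      if s: "s \<in> space M" for s
    proof (cases "s \<in> ?E")
      case True
      have "cmod (iexp (t * U n s) - iexp (t * S n s)) \<le> 1 + 1"
        by (rule order_trans[OF norm_triangle_ineq4]) simp
      also have "\<dots> \<le> \<bar>t\<bar> * e + 2 * indicator ?E s"
        using True e by simp
      finally show ?thesis .
    next
      case False
      have "cmod (iexp (t * U n s) - iexp (t * S n s)) \<le> \<bar>t\<bar> * \<bar>U n s - S n s\<bar>"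
        using norm_iexp_diff_le[of "t * U n s" "t * S n s"]
        by (simp add: abs_mult flip: right_diff_distrib)
      also have "\<dots> \<le> \<bar>t\<bar> * e"
        using False s by (intro mult_left_mono) auto
      finally show ?thesis using False by simp
    qed
    have "cmod (char (distr M borel (U n)) t - char (distr M borel (S n)) t) =
        cmod (expectation (\<lambda>s. iexp (t * U n s) - iexp (t * S n s)))"
      using int by (simp add: char_def integral_distr)
    also have "\<dots> \<le> expectation (\<lambda>s. cmod (iexp (t * U n s) - iexp (t * S n s)))"
      by (rule integral_norm_bound)
    also have "\<dots> \<le> expectation (\<lambda>s. \<bar>t\<bar> * e + 2 * indicator ?E s)"
    proof (rule integral_mono)
      show "integrable M (\<lambda>s. cmod (iexp (t * U n s) - iexp (t * S n s)))"
        using int by (intro integrable_norm Bochner_Integration.integrable_diff)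
      show "integrable M (\<lambda>s. \<bar>t\<bar> * e + 2 * indicator ?E s)"
        using ind by (intro Bochner_Integration.integrable_add integrable_const)
    qed (rule bound)
    also have "\<dots> = \<bar>t\<bar> * e + 2 * prob ?E"
      using ind by (subst Bochner_Integration.integral_add) (simp_all add: prob_space)
    finally show ?case
      using elim te by simp
  qed
qed

text \<open>Combined with Levy's continuity theorem, the comparison above reduces weak convergence
  of \<open>U\<close> to the characteristic functions of the simpler sequence
  \<open>S\<close>.\<close>

lemma weak_conv_m_of_whp:
  fixes U S :: "nat \<Rightarrow> 'a \<Rightarrow> real"
  assumes U: "\<And>n. U n \<in> borel_measurable M" and S: "\<And>n. S n \<in> borel_measurable M"
    and diff: "((\<lambda>(n, s). U n s - S n s) \<longlongrightarrow> 0) (whp M)"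
    and \<mu>: "real_distribution \<mu>" "\<And>t. (\<lambda>n. char (distr M borel (S n)) t) \<longlonglongrightarrow> char \<mu> t"
  shows "weak_conv_m (\<lambda>n. distr M borel (U n)) \<mu>"
proof (rule levy_continuity[OF real_distribution_distr[OF U] \<mu>(1)])
  fix t
  show "(\<lambda>n. char (distr M borel (U n)) t) \<longlonglongrightarrow> char \<mu> t"
    using tendsto_add[OF char_distr_diff_tendsto_0[OF U S diff, of t] \<mu>(2)[of t]] by simp
qed

section \<open>Second moments of sums of independent variables\<close>

text \<open>Induction on \<open>n\<close>: the new summand is centred and independent of the
  previous partial sum, so the cross term has expectation zero.\<close>

lemma
  fixes W :: "nat \<Rightarrow> 'a \<Rightarrow> real"
  assumes indep: "indep_vars (\<lambda>_. borel) W UNIV"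
    and sq: "\<And>i. integrable M (\<lambda>s. (W i s)\<^sup>2)" and mean: "\<And>i. expectation (W i) = 0"
  shows integrable_sum_sq_indep: "integrable M (\<lambda>s. (\<Sum>i<n. W i s)\<^sup>2)"
    and expectation_sum_sq_indep:
      "expectation (\<lambda>s. (\<Sum>i<n. W i s)\<^sup>2) = (\<Sum>i<n. expectation (\<lambda>s. (W i s)\<^sup>2))"
proof -
  have W[measurable]: "W i \<in> borel_measurable M" for i
    using indep by (auto simp: indep_vars_def)
  have int: "integrable M (W i)" for i
    using square_integrable_imp_integrable[OF W sq] .
  have "integrable M (\<lambda>s. (\<Sum>i<n. W i s)\<^sup>2) \<and>
      expectation (\<lambda>s. (\<Sum>i<n. W i s)\<^sup>2) = (\<Sum>i<n. expectation (\<lambda>s. (W i s)\<^sup>2))"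
  proof (induction n)
    case (Suc n)
    let ?S = "\<lambda>s. \<Sum>i<n. W i s"
    have S: "integrable M ?S" using int by auto
    have "indep_var borel (W n) borel ?S"
      by (rule indep_vars_sum) (auto intro: indep_vars_subset[OF indep])
    note prod = indep_var_integrable[OF this int S] indep_var_lebesgue_integral[OF this int S]
    have eq: "(\<lambda>s. (\<Sum>i<Suc n. W i s)\<^sup>2) = (\<lambda>s. (?S s)\<^sup>2 + 2 * (W n s * ?S s) + (W n s)\<^sup>2)"
      by (simp add: power2_eq_square algebra_simps)
    show ?case unfolding eq using Suc prod sq mean
      by simp
  qed simp
  then show "integrable M (\<lambda>s. (\<Sum>i<n. W i s)\<^sup>2)"
    "expectation (\<lambda>s. (\<Sum>i<n. W i s)\<^sup>2) = (\<Sum>i<n. expectation (\<lambda>s. (W i s)\<^sup>2))" by auto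
qed

text \<open>Centring reduces this to the mean-zero case; a variance is at most the raw second moment
  \<open>b\<close>, which is all that the law of large numbers below requires.\<close>

lemma
  fixes W :: "nat \<Rightarrow> 'a \<Rightarrow> real"
  assumes indep: "indep_vars (\<lambda>_. borel) W UNIV"
    and sq: "\<And>i. integrable M (\<lambda>s. (W i s)\<^sup>2)"
    and mean: "\<And>i. expectation (W i) = a" and moment: "\<And>i. expectation (\<lambda>s. (W i s)\<^sup>2) = b"
  shows integrable_sum_sq_dev: "integrable M (\<lambda>s. ((\<Sum>i<n. W i s) - real n * a)\<^sup>2)"
    and expectation_sum_sq_dev: "expectation (\<lambda>s. ((\<Sum>i<n. W i s) - real n * a)\<^sup>2) \<le> real n * b"
proof -
  have W[measurable]: "W i \<in> borel_measurable M" for i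
    using indep by (auto simp: indep_vars_def)
  have int: "integrable M (W i)" for i
    using square_integrable_imp_integrable[OF W sq] .
  let ?V = "\<lambda>i s. W i s - a"
  have V: "indep_vars (\<lambda>_. borel) ?V UNIV"
    by (rule indep_vars_compose2[OF indep]) auto
  have sqV: "integrable M (\<lambda>s. (?V i s)\<^sup>2)" for i
    using sq int by (simp add: power2_diff)
  have meanV: "expectation (?V i) = 0" for i
    using int mean by (simp add: prob_space)
  have momV: "expectation (\<lambda>s. (?V i s)\<^sup>2) \<le> b" for i
  proof -
    have "expectation (\<lambda>s. (?V i s)\<^sup>2) = b + a\<^sup>2 - 2 * a * a"
      using sq int mean moment by (simp add: power2_diff prob_space)
    then show ?thesis by (simp add: power2_eq_square)
  qed
  have eq: "(\<Sum>i<n. W i s) - real n * a = (\<Sum>i<n. ?V i s)" for s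
    by (simp add: sum_subtractf)
  show "integrable M (\<lambda>s. ((\<Sum>i<n. W i s) - real n * a)\<^sup>2)"
    unfolding eq by (rule integrable_sum_sq_indep[OF V sqV meanV])
  show "expectation (\<lambda>s. ((\<Sum>i<n. W i s) - real n * a)\<^sup>2) \<le> real n * b"
    unfolding eq expectation_sum_sq_indep[OF V sqV meanV]
    using sum_mono[of "{..<n}" "\<lambda>i. expectation (\<lambda>s. (?V i s)\<^sup>2)" "\<lambda>_. b"] momV by simp
qed

end

subsection \<open>Kernel integrals and characteristic functions\<close>

text \<open>Dominated convergence applied to the sequence shifted by \<open>n0\<close>, the index
  from which the bound holds.\<close>

lemma
  fixes g :: "nat \<Rightarrow> 'a \<Rightarrow> 'e::{banach, second_countable_topology}"
  assumes meas: "G \<in> borel_measurable M" "\<And>n. g n \<in> borel_measurable M" and w: "integrable M w"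
    and lim: "\<And>u. u \<in> space M \<Longrightarrow> (\<lambda>n. g n u) \<longlonglongrightarrow> G u"
    and bound: "\<forall>\<^sub>F n in sequentially. \<forall>u\<in>space M. norm (g n u) \<le> w u"
  shows integral_tendsto_dominated_eventually: "(\<lambda>n. integral\<^sup>L M (g n)) \<longlonglongrightarrow> integral\<^sup>L M G"
    and eventually_integrable_dominated: "\<forall>\<^sub>F n in sequentially. integrable M (g n)"
proof -
  obtain n0 where n0: "\<And>n u. n \<ge> n0 \<Longrightarrow> u \<in> space M \<Longrightarrow> norm (g n u) \<le> w u"
    using bound unfolding eventually_sequentially by blast
  have "(\<lambda>n. integral\<^sup>L M (g (n + n0))) \<longlonglongrightarrow> integral\<^sup>L M G"
    using meas w lim n0
    by (intro integral_dominated_convergence[where w=w])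
      (auto intro!: AE_I2 LIMSEQ_ignore_initial_segment[where f="\<lambda>n. g n _"])
  then show "(\<lambda>n. integral\<^sup>L M (g n)) \<longlonglongrightarrow> integral\<^sup>L M G"
    by (rule LIMSEQ_offset)
  show "\<forall>\<^sub>F n in sequentially. integrable M (g n)"
    unfolding eventually_sequentially
  proof (intro exI allI impI)
    fix n assume "n0 \<le> n"
    then show "integrable M (g n)"
      using n0 w meas by (intro Bochner_Integration.integrable_bound[OF w]) (auto intro: order_trans[OF _ abs_ge_self])
  qed
qed

section \<open>Integrals of kernels with bounded support\<close>

text \<open>Signs are left free so that odd moment kernels such as \<open>K u * u\<close> qualify.
  The class is closed under absolute values and multiplication by powers; squares enter through
  separate assumptions.\<close>

definition kernel_like :: "(real \<Rightarrow> real) \<Rightarrow> bool" where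
  "kernel_like k \<longleftrightarrow> integrable lborel k \<and> bounded {u. k u \<noteq> 0}"

lemma kernel_like_measurable: "kernel_like k \<Longrightarrow> k \<in> borel_measurable borel"
  using borel_measurable_integrable[of lborel k] by (simp add: kernel_like_def)

lemma kernel_like_support:
  assumes "kernel_like k"
  obtains b where "b > 0" "\<And>u. k u \<noteq> 0 \<Longrightarrow> \<bar>u\<bar> \<le> b"
proof -
  have "bounded {u. k u \<noteq> 0}" using assms by (simp add: kernel_like_def)
  then show ?thesis unfolding bounded_pos using that by auto
qed

text \<open>On the bounded support of \<open>k\<close> a locally bounded factor is bounded by a
  constant \<open>B\<close>, so the product is dominated by a multiple of \<open>k\<close>.\<close>

lemma kernel_like_bounded_mult:
  assumes k: "kernel_like k" and p: "p \<in> borel_measurable borel" "\<And>b. \<exists>B. \<forall>u. \<bar>u\<bar> \<le> b \<longrightarrow> \<bar>p u\<bar> \<le> B"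
  shows "kernel_like (\<lambda>u. k u * p u)"
proof -
  note [measurable] = kernel_like_measurable[OF k] p(1)
  obtain b where b: "\<And>u. k u \<noteq> 0 \<Longrightarrow> \<bar>u\<bar> \<le> b" using kernel_like_support[OF k] by metis
  obtain B where B: "\<And>u. \<bar>u\<bar> \<le> b \<Longrightarrow> \<bar>p u\<bar> \<le> B" using p(2)[of b] by metis
  have le: "\<bar>k u * p u\<bar> \<le> \<bar>k u * B\<bar>" for u
  proof (cases "k u = 0")
    case False
    then have "\<bar>p u\<bar> \<le> \<bar>B\<bar>" using B[OF b] abs_ge_self order_trans by metis
    then show ?thesis by (simp add: abs_mult mult_left_mono)
  qed simp
  have "integrable lborel (\<lambda>u. k u * p u)"
  proof (rule Bochner_Integration.integrable_bound[where f="\<lambda>u. k u * B"])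
    show "integrable lborel (\<lambda>u. k u * B)"
      using k by (simp add: kernel_like_def)
    show "AE u in lborel. norm (k u * p u) \<le> norm (k u * B)"
      using le by (intro AE_I2) (simp only: real_norm_def)
  qed simp
  moreover have "bounded {u. k u * p u \<noteq> 0}"
    by (rule bounded_subset[of "{u. k u \<noteq> 0}"]) (use k in \<open>auto simp: kernel_like_def\<close>)
  ultimately show ?thesis by (simp add: kernel_like_def)
qed

lemma kernel_like_mult_power:
  assumes "kernel_like k" shows "kernel_like (\<lambda>u. k u * u ^ j)"
proof (rule kernel_like_bounded_mult[OF assms])
  fix b :: real
  show "\<exists>B. \<forall>u. \<bar>u\<bar> \<le> b \<longrightarrow> \<bar>u ^ j\<bar> \<le> B"
    by (intro exI[of _ "b ^ j"]) (metis power_abs power_mono abs_ge_zero)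
qed simp

lemma kernel_like_abs: "kernel_like k \<Longrightarrow> kernel_like (\<lambda>u. \<bar>k u\<bar>)"
  by (simp add: kernel_like_def)

lemma eventually_bounded_on_support:
  fixes \<rho> :: "real \<Rightarrow> real"
  assumes k: "kernel_like k" and cont: "isCont \<rho> x" and h: "h \<longlonglongrightarrow> 0"
  shows "\<forall>\<^sub>F n in sequentially. \<forall>u. k u \<noteq> 0 \<longrightarrow> \<bar>\<rho> (x + h n * u)\<bar> \<le> \<bar>\<rho> x\<bar> + 1"
proof -
  obtain b where b: "b > 0" "\<And>u. k u \<noteq> 0 \<Longrightarrow> \<bar>u\<bar> \<le> b"
    using kernel_like_support[OF k] by blast
  obtain d where d: "d > 0" "\<And>t. \<bar>t - x\<bar> < d \<Longrightarrow> \<bar>\<rho> t - \<rho> x\<bar> < 1"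
    using cont[unfolded continuous_at_eps_delta, rule_format, of 1] by (auto simp: dist_real_def)
  \<comment> \<open>Since \<open>\<bar>u\<bar> \<le> b\<close> on the support, a bandwidth below
    \<open>d / b\<close> keeps \<open>x + h n * u\<close> within distance \<open>d\<close> of
    \<open>x\<close>.\<close>
  have "\<forall>\<^sub>F n in sequentially. \<bar>h n\<bar> < d / b"
    using tendstoD[OF h, of "d / b"] b d by simp
  then show ?thesis
  proof eventually_elim
    case (elim n)
    show ?case
    proof (intro allI impI)
      fix u assume u: "k u \<noteq> 0"
      have "\<bar>h n * u\<bar> \<le> \<bar>h n\<bar> * b"
        using b(2)[OF u] by (simp add: abs_mult mult_left_mono)
      also have "\<dots> < d" using elim b by (simp add: field_simps)
      finally show "\<bar>\<rho> (x + h n * u)\<bar> \<le> \<bar>\<rho> x\<bar> + 1"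
        using d(2)[of "x + h n * u"] by auto
    qed
  qed
qed

lemma tendsto_affine_arg:
  fixes x u :: real
  assumes "isCont \<rho> x" "h \<longlonglongrightarrow> 0"
  shows "(\<lambda>n. \<rho> (x + h n * u)) \<longlonglongrightarrow> \<rho> x"
proof (rule isCont_tendsto_compose[OF assms(1)])
  show "(\<lambda>n. x + h n * u) \<longlonglongrightarrow> x"
    using tendsto_add[OF tendsto_const[of x] tendsto_mult_left_zero[OF assms(2), of u]] by simp
qed

text \<open>Dominated convergence with majorant
  \<open>\<bar>k u\<bar> * (\<bar>\<rho> x\<bar> + 1)\<close>: continuity at the single point
  \<open>x\<close> suffices, because the shrinking bandwidth pulls the whole support into a
  neighbourhood of \<open>x\<close>.\<close>

lemma
  fixes \<rho> :: "real \<Rightarrow> real"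
  assumes k: "kernel_like k" and [measurable]: "\<rho> \<in> borel_measurable borel"
    and cont: "isCont \<rho> x" and h: "h \<longlonglongrightarrow> 0"
  shows kernel_integral_tendsto:
      "(\<lambda>n. LINT u|lborel. k u * \<rho> (x + h n * u)) \<longlonglongrightarrow> (LINT u|lborel. k u) * \<rho> x"
    and kernel_integrable_eventually:
      "\<forall>\<^sub>F n in sequentially. integrable lborel (\<lambda>u. k u * \<rho> (x + h n * u))"
proof -
  note [measurable] = kernel_like_measurable[OF k]
  have w: "integrable lborel (\<lambda>u. \<bar>k u\<bar> * (\<bar>\<rho> x\<bar> + 1))"
    using k by (auto simp: kernel_like_def)
  have lim: "(\<lambda>n. k u * \<rho> (x + h n * u)) \<longlonglongrightarrow> k u * \<rho> x" for u
    by (intro tendsto_mult tendsto_const tendsto_affine_arg[OF cont h])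
  have bound: "\<forall>\<^sub>F n in sequentially. \<forall>u\<in>space lborel. norm (k u * \<rho> (x + h n * u)) \<le> \<bar>k u\<bar> * (\<bar>\<rho> x\<bar> + 1)"
    using eventually_bounded_on_support[OF k cont h]
  proof eventually_elim
    case (elim n)
    have "\<bar>k u * \<rho> (x + h n * u)\<bar> \<le> \<bar>k u\<bar> * (\<bar>\<rho> x\<bar> + 1)" for u
      using elim[rule_format, of u] by (cases "k u = 0") (auto simp: abs_mult mult_left_mono)
    then show ?case by simp
  qed
  have "(\<lambda>n. LINT u|lborel. k u * \<rho> (x + h n * u)) \<longlonglongrightarrow> (LINT u|lborel. k u * \<rho> x)"
    by (rule integral_tendsto_dominated_eventually[OF _ _ w lim bound]) auto
  then show "(\<lambda>n. LINT u|lborel. k u * \<rho> (x + h n * u)) \<longlonglongrightarrow> (LINT u|lborel. k u) * \<rho> x"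
    by simp
  show "\<forall>\<^sub>F n in sequentially. integrable lborel (\<lambda>u. k u * \<rho> (x + h n * u))"
    by (rule eventually_integrable_dominated[OF _ _ w lim bound]) auto
qed

text \<open>Integration against the density followed by the substitution
  \<open>t = x + h * u\<close>. The resulting factor \<open>h\<close> explains the normalisation of
  kernel sums by \<open>n h\<close>.\<close>

lemma
  fixes g :: "real \<Rightarrow> 'e::{banach, second_countable_topology}"
  assumes X: "distributed P lborel X (\<lambda>t. ennreal (f t))" and f: "\<And>t. f t \<ge> 0"
    and [measurable]: "g \<in> borel_measurable borel" and h: "h > 0"
  shows distributed_integral_rescale:
      "(LINT s|P. g (X s)) = h *\<^sub>R (LINT u|lborel. f (x + h * u) *\<^sub>R g (x + h * u))"
    and distributed_integrable_rescale:
      "integrable P (\<lambda>s. g (X s)) \<longleftrightarrow> integrable lborel (\<lambda>u. f (x + h * u) *\<^sub>R g (x + h * u))"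
proof -
  have [measurable]: "X \<in> borel_measurable P" "f \<in> borel_measurable borel"
    using distributed_measurable[OF X] distributed_real_measurable[OF _ X] f by auto
  have distr: "distr P lborel X = density lborel (\<lambda>t. ennreal (f t))"
    using X by (simp add: distributed_def)
  have "(LINT s|P. g (X s)) = (LINT t|distr P lborel X. g t)"
    by (simp add: integral_distr)
  also have "\<dots> = (LINT t|lborel. f t *\<^sub>R g t)"
    unfolding distr using f by (subst integral_density) auto
  also have "\<dots> = h *\<^sub>R (LINT u|lborel. f (x + h * u) *\<^sub>R g (x + h * u))"
    using h lborel_integral_real_affine[of h "\<lambda>t. f t *\<^sub>R g t" x] by simp
  finally show "(LINT s|P. g (X s)) = h *\<^sub>R (LINT u|lborel. f (x + h * u) *\<^sub>R g (x + h * u))" .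
  have "integrable P (\<lambda>s. g (X s)) \<longleftrightarrow> integrable (distr P lborel X) g"
    by (simp add: integrable_distr_eq)
  also have "\<dots> \<longleftrightarrow> integrable lborel (\<lambda>t. f t *\<^sub>R g t)"
    unfolding distr using f by (subst integrable_density) auto
  also have "\<dots> \<longleftrightarrow> integrable lborel (\<lambda>u. f (x + h * u) *\<^sub>R g (x + h * u))"
    using h lborel_integrable_real_affine_iff[of h "\<lambda>t. f t *\<^sub>R g t" x] by simp
  finally show "integrable P (\<lambda>s. g (X s)) \<longleftrightarrow>
      integrable lborel (\<lambda>u. f (x + h * u) *\<^sub>R g (x + h * u))" .
qed

section \<open>Powers and second-order expansions of characteristic functions\<close>

text \<open>In the closed unit disc, \<open>n\<close>-th powers differ by at most \<open>n\<close>
  times the difference of their bases. The comparison base is \<open>exp (c / n)\<close>, which lies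
  in the disc because \<open>c \<le> 0\<close>; this avoids complex logarithms.\<close>

lemma tendsto_power_exp:
  fixes z :: "nat \<Rightarrow> complex" and c :: real
  assumes z: "\<And>n. norm (z n) \<le> 1" and c: "c \<le> 0" and lim: "(\<lambda>n. of_nat n * (z n - 1)) \<longlonglongrightarrow> of_real c"
  shows "(\<lambda>n. z n ^ n) \<longlonglongrightarrow> of_real (exp c)"
proof -
  have "(\<lambda>n. real n * (exp (c / real n) - 1)) \<longlonglongrightarrow> c"
    by real_asymp
  then have "(\<lambda>n. of_real (real n * (exp (c / real n) - 1)) :: complex) \<longlonglongrightarrow> of_real c"
    by (rule tendsto_of_real)
  from tendsto_norm[OF tendsto_diff[OF lim this]]
  have *: "(\<lambda>n. norm (of_nat n * (z n - of_real (exp (c / real n))))) \<longlonglongrightarrow> 0"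
    by (simp add: algebra_simps)
  have "(\<lambda>n. z n ^ n - of_real (exp (c / real n)) ^ n) \<longlonglongrightarrow> 0"
  proof (rule Lim_null_comparison[OF always_eventually *], rule allI)
    fix n
    show "norm (z n ^ n - of_real (exp (c / real n)) ^ n) \<le>
        norm (of_nat n * (z n - of_real (exp (c / real n))))"
      using norm_power_diff[OF z[of n], of "of_real (exp (c / real n))" n] c
      by (simp add: norm_mult divide_nonpos_nonneg)
  qed
  moreover have "(\<lambda>n. of_real (exp (c / real n)) ^ n :: complex) \<longlonglongrightarrow> of_real (exp c)"
  proof (rule tendsto_eventually, unfold eventually_sequentially, intro exI allI impI)
    \<comment> \<open>Index 0 is excluded: there the power is 1, which in general differs from
      \<open>exp c\<close>.\<close>
    fix n :: nat assume "1 \<le> n"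
    then show "of_real (exp (c / real n)) ^ n = (of_real (exp c) :: complex)"
      by (simp flip: of_real_power exp_of_nat_mult)
  qed
  ultimately show ?thesis
    using tendsto_add by fastforce
qed

text \<open>The expansion is written with an exact bounded factor \<open>F\<close>, continuous at 0,
  rather than with a little-o term. In this form it can be evaluated at arguments depending on an
  integration variable and passed to dominated convergence.\<close>

lemma (in real_distribution) char_second_order:
  assumes int: "integrable M (\<lambda>y. y\<^sup>2)" and mean: "expectation (\<lambda>y. y) = 0"
  defines "v \<equiv> expectation (\<lambda>y. y\<^sup>2)"
  obtains F where "F \<in> borel_measurable borel" "isCont F 0" "F 0 = of_real (- v / 2)"
    "\<And>a. char M a = 1 + of_real (a\<^sup>2) * F a" "\<And>a. norm (F a) \<le> 3 / 2 * v"
proof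
  define F where "F a = (if a = 0 then of_real (- v / 2) else (char M a - 1) / of_real (a\<^sup>2))" for a
  \<comment> \<open>The remainder of the Taylor estimate \<open>char_approx3\<close>. The minimum is
    dominated by \<open>6 * y\<^sup>2\<close>, so a finite second moment suffices both for
    \<open>R a \<le> 6 * v\<close> and for the convergence of \<open>R\<close> to 0 at
    \<open>a = 0\<close>.\<close>
  define R where "R a = expectation (\<lambda>y. min (6 * y\<^sup>2) (\<bar>a\<bar> * \<bar>y\<bar> ^ 3))" for a
  have int1: "integrable M (\<lambda>y. y)"
    by (rule square_integrable_imp_integrable[OF _ int]) simp
  have R_le: "R a \<le> 6 * v" and R_nonneg: "R a \<ge> 0" for a
  proof -
    have 6: "integrable M (\<lambda>y. 6 * y\<^sup>2)" using int by simp
    have "integrable M (\<lambda>y. min (6 * y\<^sup>2) (\<bar>a\<bar> * \<bar>y\<bar> ^ 3))"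
      by (rule Bochner_Integration.integrable_bound[OF 6]) auto
    then have "R a \<le> expectation (\<lambda>y. 6 * y\<^sup>2)"
      unfolding R_def using 6 by (rule integral_mono) auto
    then show "R a \<le> 6 * v" by (simp add: v_def)
    show "R a \<ge> 0" unfolding R_def by (intro integral_nonneg_AE) auto
  qed
  have v: "v \<ge> 0" unfolding v_def by simp
  have close: "norm (F a - of_real (- v / 2)) \<le> R a / 6" for a
  proof (cases "a = 0")
    case False
    have "norm (char M a - (1 - a\<^sup>2 * v / 2)) \<le> a\<^sup>2 / 6 * R a"
      unfolding R_def using int int1 mean by (intro char_approx3) (auto simp: v_def)
    moreover have "char M a - (1 - a\<^sup>2 * v / 2) = of_real (a\<^sup>2) * (F a - of_real (- v / 2))"
      using False by (simp add: F_def field_simps)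
    ultimately have "a\<^sup>2 * norm (F a - of_real (- v / 2)) \<le> a\<^sup>2 * (R a / 6)"
      by (simp only: norm_mult norm_of_real abs_power2)
    then show ?thesis
      by (rule mult_left_le_imp_le) (use False in simp)
  qed (use R_nonneg in \<open>simp add: F_def\<close>)
  show "norm (F a) \<le> 3 / 2 * v" for a
  proof -
    have "norm (F a) \<le> norm (F a - of_real (- v / 2)) + norm (of_real (- v / 2) :: complex)"
      by (metis diff_add_cancel norm_triangle_ineq)
    also have "norm (of_real (- v / 2) :: complex) = v / 2" using v by (simp del: of_real_divide of_real_minus)
    finally show ?thesis using close[of a] R_le[of a] by simp
  qed
  show "F \<in> borel_measurable borel" unfolding F_def by measurable
  show "F 0 = of_real (- v / 2)" by (simp add: F_def)
  show "char M a = 1 + of_real (a\<^sup>2) * F a" for a by (simp add: F_def char_zero)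
  show "isCont F 0"
    unfolding continuous_at_sequentially
  proof safe
    fix a :: "nat \<Rightarrow> real" assume a: "a \<longlonglongrightarrow> 0"
    have "(\<lambda>n. R (a n)) \<longlonglongrightarrow> expectation (\<lambda>y. 0)"
      unfolding R_def
    proof (rule integral_dominated_convergence[where w="\<lambda>y. 6 * y\<^sup>2"])
      show "AE y in M. (\<lambda>n. min (6 * y\<^sup>2) (\<bar>a n\<bar> * \<bar>y\<bar> ^ 3)) \<longlonglongrightarrow> 0"
      proof (rule AE_I2)
        fix y :: real
        have "(\<lambda>n. min (6 * y\<^sup>2) (\<bar>a n\<bar> * \<bar>y\<bar> ^ 3)) \<longlonglongrightarrow> min (6 * y\<^sup>2) (\<bar>0\<bar> * \<bar>y\<bar> ^ 3)"
          using a by (intro tendsto_intros)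
        then show "(\<lambda>n. min (6 * y\<^sup>2) (\<bar>a n\<bar> * \<bar>y\<bar> ^ 3)) \<longlonglongrightarrow> 0" by simp
      qed
    qed (use int in auto)
    then have "(\<lambda>n. R (a n) / 6) \<longlonglongrightarrow> 0" by (simp add: tendsto_divide_zero)
    then have "(\<lambda>n. F (a n) - of_real (- v / 2)) \<longlonglongrightarrow> 0"
      by (rule Lim_null_comparison[OF always_eventually, rotated]) (use close in auto)
    then show "(F \<circ> a) \<longlonglongrightarrow> F 0"
      by (simp add: comp_def F_def[of 0] LIM_zero_iff del: of_real_minus of_real_divide)
  qed
qed

subsection \<open>Kernel sums over a sample with multiplicative noise\<close>

text \<open>The real-valued problem left after projecting onto one direction:
  \<open>\<tau> X * \<eta>\<close> is the projected error in the model and \<open>Gs i\<close> its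
  sample counterpart. The two probability spaces are linked only through the joint law, and
  regularity is demanded only at \<open>x\<close>.\<close>

locale local_sample = prob_space M for M :: "'c measure" +
  fixes P :: "'b measure" and X \<eta> :: "'b \<Rightarrow> real" and f \<tau> :: "real \<Rightarrow> real" and x :: real
    and Xs Gs :: "nat \<Rightarrow> 'c \<Rightarrow> real" and h :: "nat \<Rightarrow> real"
  assumes P: "prob_space P"
    and X_distributed: "distributed P lborel X (\<lambda>t. ennreal (f t))"
    and f_nonneg: "\<And>t. f t \<ge> 0" and f_cont: "isCont f x"
    and \<tau>_meas [measurable]: "\<tau> \<in> borel_measurable borel" and \<tau>_cont: "isCont \<tau> x"
    and X_\<eta>_indep: "prob_space.indep_var P borel X borel \<eta>"
    and \<eta>_mean: "(LINT s|P. \<eta> s) = 0" and \<eta>_sq: "integrable P (\<lambda>s. (\<eta> s)\<^sup>2)"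
    and sample_indep: "indep_vars (\<lambda>_. borel \<Otimes>\<^sub>M borel) (\<lambda>i s. (Xs i s, Gs i s)) UNIV"
    and sample_distr: "\<And>i. distr M (borel \<Otimes>\<^sub>M borel) (\<lambda>s. (Xs i s, Gs i s))
        = distr P (borel \<Otimes>\<^sub>M borel) (\<lambda>s. (X s, \<tau> (X s) * \<eta> s))"
    and h_pos: "\<And>n. h n > 0" and h_lim: "h \<longlonglongrightarrow> 0"
    and nh_lim: "filterlim (\<lambda>n. real n * h n) at_top sequentially"
begin

sublocale P: prob_space P by (rule P)

definition noise_var :: real where "noise_var = (LINT s|P. (\<eta> s)\<^sup>2)"

lemma X_meas [measurable]: "X \<in> borel_measurable P" and \<eta>_meas [measurable]: "\<eta> \<in> borel_measurable P"
  using P.indep_var_rv1[OF X_\<eta>_indep] P.indep_var_rv2[OF X_\<eta>_indep] by auto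

lemma f_meas [measurable]: "f \<in> borel_measurable borel"
  using distributed_real_measurable[OF _ X_distributed] f_nonneg by auto

lemma sample_meas: "(\<lambda>s. (Xs i s, Gs i s)) \<in> M \<rightarrow>\<^sub>M borel \<Otimes>\<^sub>M borel"
  using sample_indep by (auto simp: indep_vars_def)

lemma Xs_meas [measurable]: "Xs i \<in> borel_measurable M" and Gs_meas [measurable]: "Gs i \<in> borel_measurable M"
  using measurable_compose[OF sample_meas[of i] measurable_fst]
    measurable_compose[OF sample_meas[of i] measurable_snd] by simp_all

lemma \<eta>_integrable: "integrable P \<eta>"
  by (rule P.square_integrable_imp_integrable[OF _ \<eta>_sq]) simp

lemma inverse_nh_lim: "(\<lambda>n. 1 / (real n * h n)) \<longlonglongrightarrow> 0"
  using tendsto_inverse_0_at_top[OF nh_lim] by (simp add: inverse_eq_divide)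

text \<open>Equality of laws moves every moment of a sample point to \<open>P\<close>, where the
  error is an explicit product and the independence of \<open>X\<close> and \<open>\<eta>\<close> is
  available.\<close>

lemma
  fixes \<phi> :: "real \<Rightarrow> real \<Rightarrow> 'e::{banach, second_countable_topology}"
  assumes [measurable]: "case_prod \<phi> \<in> borel_measurable (borel \<Otimes>\<^sub>M borel)"
  shows sample_expectation:
      "expectation (\<lambda>s. \<phi> (Xs i s) (Gs i s)) = P.expectation (\<lambda>s. \<phi> (X s) (\<tau> (X s) * \<eta> s))"
    and sample_integrable:
      "integrable M (\<lambda>s. \<phi> (Xs i s) (Gs i s)) \<longleftrightarrow> integrable P (\<lambda>s. \<phi> (X s) (\<tau> (X s) * \<eta> s))"
proof -
  have "expectation (\<lambda>s. \<phi> (Xs i s) (Gs i s)) =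
      integral\<^sup>L (distr M (borel \<Otimes>\<^sub>M borel) (\<lambda>s. (Xs i s, Gs i s))) (case_prod \<phi>)"
    by (subst integral_distr) auto
  also have "\<dots> = P.expectation (\<lambda>s. \<phi> (X s) (\<tau> (X s) * \<eta> s))"
    unfolding sample_distr by (subst integral_distr) auto
  finally show "expectation (\<lambda>s. \<phi> (Xs i s) (Gs i s)) = P.expectation (\<lambda>s. \<phi> (X s) (\<tau> (X s) * \<eta> s))" .
  have "integrable M (\<lambda>s. \<phi> (Xs i s) (Gs i s)) \<longleftrightarrow>
      integrable (distr M (borel \<Otimes>\<^sub>M borel) (\<lambda>s. (Xs i s, Gs i s))) (case_prod \<phi>)"
    by (subst integrable_distr_eq) auto
  also have "\<dots> \<longleftrightarrow> integrable P (\<lambda>s. \<phi> (X s) (\<tau> (X s) * \<eta> s))"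
    unfolding sample_distr by (subst integrable_distr_eq) auto
  finally show "integrable M (\<lambda>s. \<phi> (Xs i s) (Gs i s)) \<longleftrightarrow> integrable P (\<lambda>s. \<phi> (X s) (\<tau> (X s) * \<eta> s))" .
qed

lemma
  fixes g :: "real \<Rightarrow> real \<Rightarrow> 'e::{banach, second_countable_topology}"
  assumes [measurable]: "case_prod g \<in> borel_measurable (borel \<Otimes>\<^sub>M borel)"
  shows local_integral: "(LINT s|P. g ((X s - x) / h n) (X s)) =
      h n *\<^sub>R (LINT u|lborel. f (x + h n * u) *\<^sub>R g u (x + h n * u))"
    and local_integrable: "integrable P (\<lambda>s. g ((X s - x) / h n) (X s)) \<longleftrightarrow>
      integrable lborel (\<lambda>u. f (x + h n * u) *\<^sub>R g u (x + h n * u))"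
  using distributed_integral_rescale[OF X_distributed f_nonneg _ h_pos[of n], of "\<lambda>t. g ((t - x) / h n) t" x]
    distributed_integrable_rescale[OF X_distributed f_nonneg _ h_pos[of n], of "\<lambda>t. g ((t - x) / h n) t" x]
    h_pos[of n]
  by simp_all

section \<open>Law of large numbers for kernel averages\<close>

text \<open>For \<open>k = K\<close> this is the kernel density estimate at \<open>x\<close>. With
  \<open>k u = K u * u ^ j\<close> it is the \<open>A\<^sub>j\<close> of the overview, and
  \<open>knoise\<close> is then \<open>S\<^sub>j\<close>.\<close>

definition kmean :: "(real \<Rightarrow> real) \<Rightarrow> nat \<Rightarrow> 'c \<Rightarrow> real" where
  "kmean k n s = (\<Sum>i<n. k ((Xs i s - x) / h n)) / (real n * h n)"

definition knoise :: "(real \<Rightarrow> real) \<Rightarrow> nat \<Rightarrow> 'c \<Rightarrow> real" where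
  "knoise k n s = (\<Sum>i<n. k ((Xs i s - x) / h n) * Gs i s) / sqrt (real n * h n)"

lemma kmean_measurable: "kernel_like k \<Longrightarrow> kmean k n \<in> borel_measurable M"
  using kernel_like_measurable[of k] unfolding kmean_def by measurable

lemma knoise_measurable: "kernel_like k \<Longrightarrow> knoise k n \<in> borel_measurable M"
  using kernel_like_measurable[of k] unfolding knoise_def by measurable

text \<open>The deviation is measured from the exact mean \<open>a n\<close>, so that the bias
  remains a deterministic limit. One summand has second moment \<open>h n * b n\<close>, and
  dividing the sum of \<open>n\<close> of them by the squared normalisation leaves
  \<open>b n / (n h)\<close>.\<close>

lemma expectation_kmean_dev:
  assumes k: "kernel_like k" and k2: "kernel_like (\<lambda>u. (k u)\<^sup>2)"
  defines "a \<equiv> \<lambda>n. LINT u|lborel. k u * f (x + h n * u)"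
    and "b \<equiv> \<lambda>n. LINT u|lborel. (k u)\<^sup>2 * f (x + h n * u)"
  shows "\<forall>\<^sub>F n in sequentially. integrable M (\<lambda>s. (kmean k n s - a n)\<^sup>2) \<and>
    expectation (\<lambda>s. (kmean k n s - a n)\<^sup>2) \<le> b n * (1 / (real n * h n))"
  using kernel_integrable_eventually[OF k2 f_meas f_cont h_lim] eventually_gt_at_top[of 0]
proof eventually_elim
  case (elim n)
  note [measurable] = kernel_like_measurable[OF k]
  define W where "W i s = k ((Xs i s - x) / h n)" for i s
  have nh: "real n * h n > 0" using elim h_pos[of n] by simp
  have indep: "indep_vars (\<lambda>_. borel) W UNIV"
    unfolding W_def
    by (rule indep_vars_compose2[OF sample_indep, of "\<lambda>_ (t, y). k ((t - x) / h n)", simplified]) simp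
  have sq: "integrable M (\<lambda>s. (W i s)\<^sup>2)" for i
    unfolding W_def
    using sample_integrable[of "\<lambda>t y. (k ((t - x) / h n))\<^sup>2" i] local_integrable[of "\<lambda>u t. (k u)\<^sup>2" n] elim
    by (simp add: mult.commute)
  have mean: "expectation (W i) = h n * a n" for i
    unfolding W_def a_def
    using sample_expectation[of "\<lambda>t y. k ((t - x) / h n)" i] local_integral[of "\<lambda>u t. k u" n]
    by (simp add: mult.commute)
  have moment: "expectation (\<lambda>s. (W i s)\<^sup>2) = h n * b n" for i
    unfolding W_def b_def
    using sample_expectation[of "\<lambda>t y. (k ((t - x) / h n))\<^sup>2" i] local_integral[of "\<lambda>u t. (k u)\<^sup>2" n]
    by (simp add: mult.commute)
  have eq: "(kmean k n s - a n)\<^sup>2 = ((\<Sum>i<n. W i s) - real n * (h n * a n))\<^sup>2 / (real n * h n)\<^sup>2" for s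
  proof -
    have "kmean k n s - a n = ((\<Sum>i<n. W i s) - real n * (h n * a n)) / (real n * h n)"
      using nh by (auto simp: kmean_def W_def diff_divide_distrib)
    then show ?thesis by (simp only: power_divide)
  qed
  note sum = integrable_sum_sq_dev[OF indep sq mean moment, of n] expectation_sum_sq_dev[OF indep sq mean moment, of n]
  have "expectation (\<lambda>s. (kmean k n s - a n)\<^sup>2) \<le> real n * (h n * b n) / (real n * h n)\<^sup>2"
    unfolding eq using sum(2) by (simp add: divide_right_mono)
  also have "\<dots> = b n * (1 / (real n * h n))"
    using nh by (simp add: power2_eq_square)
  finally show ?case
    unfolding eq using sum(1) by simp
qed

text \<open>The variance vanishes because \<open>n h\<close> tends to infinity, and the mean
  \<open>a n\<close> converges by continuity of \<open>f\<close> at \<open>x\<close>.\<close>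

theorem kmean_tendsto:
  assumes k: "kernel_like k" and k2: "kernel_like (\<lambda>u. (k u)\<^sup>2)"
  shows "((\<lambda>(n, s). kmean k n s) \<longlongrightarrow> f x * (LINT u|lborel. k u)) (whp M)"
proof -
  define a where "a n = (LINT u|lborel. k u * f (x + h n * u))" for n
  define b where "b n = (LINT u|lborel. (k u)\<^sup>2 * f (x + h n * u))" for n
  note [measurable] = kmean_measurable[OF k]
  have dev: "\<forall>\<^sub>F n in sequentially. integrable M (\<lambda>s. (kmean k n s - a n)\<^sup>2) \<and>
      expectation (\<lambda>s. (kmean k n s - a n)\<^sup>2) \<le> b n * (1 / (real n * h n))"
    using expectation_kmean_dev[OF k k2] unfolding a_def b_def .
  have "(\<lambda>n. b n * (1 / (real n * h n))) \<longlonglongrightarrow> 0"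
    using tendsto_mult[OF kernel_integral_tendsto[OF k2 f_meas f_cont h_lim] inverse_nh_lim]
    by (simp add: b_def)
  then have lim: "(\<lambda>n. expectation (\<lambda>s. (kmean k n s - a n)\<^sup>2)) \<longlonglongrightarrow> 0"
    by (rule Lim_null_comparison[rotated]) (use dev in eventually_elim, simp)
  have "((\<lambda>(n, s). kmean k n s - a n) \<longlongrightarrow> 0) (whp M)"
    by (rule tendsto_whp_L2) (use dev lim in \<open>auto elim: eventually_mono\<close>)
  moreover have "((\<lambda>(n, s). a n) \<longlongrightarrow> (LINT u|lborel. k u) * f x) (whp M)"
    unfolding a_def by (rule tendsto_whp_of_seq) (rule kernel_integral_tendsto[OF k f_meas f_cont h_lim])
  ultimately have "((\<lambda>z. (case z of (n, s) \<Rightarrow> kmean k n s - a n) + (case z of (n, s) \<Rightarrow> a n))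
      \<longlongrightarrow> 0 + (LINT u|lborel. k u) * f x) (whp M)"
    by (rule tendsto_add)
  then show ?thesis by (simp add: case_prod_unfold mult.commute)
qed

section \<open>Second moments and Gaussian limit of the noise sums\<close>

lemma \<rho>_meas: "(\<lambda>t. (\<tau> t)\<^sup>2 * f t) \<in> borel_measurable borel"
  and \<rho>_cont: "isCont (\<lambda>t. (\<tau> t)\<^sup>2 * f t) x"
  by measurable (intro continuous_intros \<tau>_cont f_cont)

text \<open>Each summand is \<open>g X * \<eta>\<close> in law, with independent factors. Its mean
  vanishes with that of \<open>\<eta>\<close>, its second moment factorises, and independence across
  the sample makes second moments add exactly.\<close>

lemma expectation_knoise_sq:
  assumes k: "kernel_like k" and k2: "kernel_like (\<lambda>u. (k u)\<^sup>2)"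
  shows "\<forall>\<^sub>F n in sequentially. integrable M (\<lambda>s. (knoise k n s)\<^sup>2) \<and>
    expectation (\<lambda>s. (knoise k n s)\<^sup>2) =
      noise_var * (LINT u|lborel. (k u)\<^sup>2 * ((\<tau> (x + h n * u))\<^sup>2 * f (x + h n * u)))"
  using kernel_integrable_eventually[OF k2 \<rho>_meas \<rho>_cont h_lim] eventually_gt_at_top[of 0]
proof eventually_elim
  case (elim n)
  note [measurable] = kernel_like_measurable[OF k]
  define c where "c = (LINT u|lborel. (k u)\<^sup>2 * ((\<tau> (x + h n * u))\<^sup>2 * f (x + h n * u)))"
  define W where "W i s = k ((Xs i s - x) / h n) * Gs i s" for i s
  define g where "g t = k ((t - x) / h n) * \<tau> t" for t
  have [measurable]: "g \<in> borel_measurable borel" unfolding g_def by measurable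
  have nh: "real n * h n > 0" using elim h_pos[of n] by simp
  have indep: "indep_vars (\<lambda>_. borel) W UNIV"
    unfolding W_def
    by (rule indep_vars_compose2[OF sample_indep, of "\<lambda>_ (t, y). k ((t - x) / h n) * y", simplified]) simp
  have g_sq: "integrable P (\<lambda>s. (g (X s))\<^sup>2)" "P.expectation (\<lambda>s. (g (X s))\<^sup>2) = h n * c"
    unfolding g_def c_def
    using local_integrable[of "\<lambda>u t. (k u * \<tau> t)\<^sup>2" n] local_integral[of "\<lambda>u t. (k u * \<tau> t)\<^sup>2" n] elim
    by (simp_all add: power_mult_distrib mult_ac)
  have g_int: "integrable P (\<lambda>s. g (X s))"
    by (rule P.square_integrable_imp_integrable[OF _ g_sq(1)]) simp
  have ind1: "P.indep_var borel (\<lambda>s. g (X s)) borel \<eta>"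
    by (rule P.indep_var_compose[OF X_\<eta>_indep, of g borel "\<lambda>y. y" borel, unfolded comp_def]) simp_all
  have ind2: "P.indep_var borel (\<lambda>s. (g (X s))\<^sup>2) borel (\<lambda>s. (\<eta> s)\<^sup>2)"
    by (rule P.indep_var_compose[OF X_\<eta>_indep, of "\<lambda>t. (g t)\<^sup>2" borel "\<lambda>y. y\<^sup>2" borel,
        unfolded comp_def]) simp_all
  have mean: "expectation (W i) = 0" for i
  proof -
    have "expectation (W i) = P.expectation (\<lambda>s. k ((X s - x) / h n) * (\<tau> (X s) * \<eta> s))"
      unfolding W_def by (rule sample_expectation) measurable
    also have "\<dots> = P.expectation (\<lambda>s. g (X s) * \<eta> s)"
      by (simp only: g_def mult.assoc)
    also have "\<dots> = 0"
      using P.indep_var_lebesgue_integral[OF ind1 g_int \<eta>_integrable] \<eta>_mean by simp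
    finally show ?thesis .
  qed
  have W_sq: "(k ((X s - x) / h n) * (\<tau> (X s) * \<eta> s))\<^sup>2 = (g (X s))\<^sup>2 * (\<eta> s)\<^sup>2" for s
    by (simp only: g_def mult.assoc flip: power_mult_distrib)
  have sq: "integrable M (\<lambda>s. (W i s)\<^sup>2)" for i
    unfolding W_def
    by (subst sample_integrable[of "\<lambda>t y. (k ((t - x) / h n) * y)\<^sup>2"], measurable, unfold W_sq)
      (rule P.indep_var_integrable[OF ind2 g_sq(1) \<eta>_sq])
  have moment: "expectation (\<lambda>s. (W i s)\<^sup>2) = h n * c * noise_var" for i
    unfolding W_def noise_var_def g_sq(2)[symmetric]
    by (subst sample_expectation[of "\<lambda>t y. (k ((t - x) / h n) * y)\<^sup>2"], measurable, unfold W_sq)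
      (rule P.indep_var_lebesgue_integral[OF ind2 g_sq(1) \<eta>_sq])
  have eq: "(knoise k n s)\<^sup>2 = (\<Sum>i<n. W i s)\<^sup>2 / (real n * h n)" for s
    using nh by (simp add: knoise_def W_def power_divide)
  have "expectation (\<lambda>s. (knoise k n s)\<^sup>2) = noise_var * c"
    unfolding eq using expectation_sum_sq_indep[OF indep sq mean, of n] moment nh by auto
  then show ?case
    unfolding c_def eq using integrable_sum_sq_indep[OF indep sq mean, of n] by simp
qed

text \<open>The second moments converge, hence eventually stay below their limit plus one.\<close>

lemma knoise_L2_bounded:
  assumes k: "kernel_like k" and k2: "kernel_like (\<lambda>u. (k u)\<^sup>2)"
  shows "\<exists>C. \<forall>\<^sub>F n in sequentially. integrable M (\<lambda>s. (knoise k n s)\<^sup>2) \<and> expectation (\<lambda>s. (knoise k n s)\<^sup>2) \<le> C"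
proof -
  let ?c = "\<lambda>n. noise_var * (LINT u|lborel. (k u)\<^sup>2 * ((\<tau> (x + h n * u))\<^sup>2 * f (x + h n * u)))"
  let ?l = "noise_var * ((LINT u|lborel. (k u)\<^sup>2) * ((\<tau> x)\<^sup>2 * f x))"
  have "?c \<longlonglongrightarrow> ?l"
    by (intro tendsto_mult tendsto_const kernel_integral_tendsto[OF k2 \<rho>_meas \<rho>_cont h_lim])
  then have "\<forall>\<^sub>F n in sequentially. ?c n < ?l + 1"
    by (rule order_tendstoD) simp
  with expectation_knoise_sq[OF k k2]
  have "\<forall>\<^sub>F n in sequentially. integrable M (\<lambda>s. (knoise k n s)\<^sup>2) \<and>
      expectation (\<lambda>s. (knoise k n s)\<^sup>2) \<le> ?l + 1"
    by eventually_elim simp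
  then show ?thesis by blast
qed

text \<open>The joint law of \<open>X\<close> and \<open>\<eta>\<close> is a product measure, so
  Fubini allows integrating out \<open>\<eta>\<close> first, which produces its characteristic
  function.\<close>

lemma expectation_iexp_mult:
  assumes [measurable]: "g \<in> borel_measurable borel"
  shows "P.expectation (\<lambda>s. iexp (g (X s) * \<eta> s)) = P.expectation (\<lambda>s. char (distr P borel \<eta>) (g (X s)))"
proof -
  let ?X = "distr P borel X" and ?E = "distr P borel \<eta>"
  interpret X: prob_space ?X by (rule P.prob_space_distr) simp
  interpret E: prob_space ?E by (rule P.prob_space_distr) simp
  interpret XE: pair_prob_space ?X ?E ..
  have joint: "?X \<Otimes>\<^sub>M ?E = distr P (borel \<Otimes>\<^sub>M borel) (\<lambda>s. (X s, \<eta> s))"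
    using X_\<eta>_indep P.indep_var_distribution_eq by blast
  have sets: "sets (?X \<Otimes>\<^sub>M ?E) = sets (borel \<Otimes>\<^sub>M borel)" by (simp add: joint)
  have meas: "(\<lambda>(t, y). iexp (g t * y)) \<in> borel_measurable (borel \<Otimes>\<^sub>M borel)"
    by measurable
  have int: "integrable (?X \<Otimes>\<^sub>M ?E) (\<lambda>(t, y). iexp (g t * y))"
    by (rule XE.integrable_const_bound[of _ 1])
      (use meas in \<open>auto simp: measurable_cong_sets[OF sets refl]\<close>)
  have "P.expectation (\<lambda>s. iexp (g (X s) * \<eta> s)) = integral\<^sup>L (?X \<Otimes>\<^sub>M ?E) (\<lambda>(t, y). iexp (g t * y))"
    unfolding joint by (subst integral_distr) (use meas in auto)
  also have "\<dots> = (LINT t|?X. LINT y|?E. iexp (g t * y))"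
    using XE.integral_fst'[OF int] by simp
  also have "\<dots> = (LINT t|?X. char ?E (g t))"
    by (simp add: char_def)
  also have "\<dots> = P.expectation (\<lambda>s. char ?E (g (X s)))"
  proof (rule integral_distr)
    interpret E: real_distribution ?E by (rule P.real_distribution_distr) simp
    show "(\<lambda>t. char ?E (g t)) \<in> borel_measurable borel" by measurable
  qed simp
  finally show ?thesis .
qed

text \<open>A central limit theorem for a triangular array. The summands have a common
  characteristic function \<open>z n\<close>, and \<open>n * (z n - 1)\<close> is an integral over
  the rescaled variable that converges by dominated convergence; \<open>tendsto_power_exp\<close>
  then gives the limit of \<open>z n ^ n\<close>.\<close>

theorem knoise_char_tendsto:
  assumes k: "kernel_like k" and k2: "kernel_like (\<lambda>u. (k u)\<^sup>2)"
  shows "(\<lambda>n. char (distr M borel (knoise k n)) t) \<longlonglongrightarrow>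
    of_real (exp (- (t\<^sup>2 * ((LINT u|lborel. (k u)\<^sup>2) * (\<tau> x)\<^sup>2 * f x * noise_var) / 2)))"
proof -
  note [measurable] = kernel_like_measurable[OF k]
  define \<nu> where "\<nu> = distr P borel \<eta>"
  interpret \<nu>: real_distribution \<nu>
    unfolding \<nu>_def by (rule P.real_distribution_distr) simp
  have "integrable \<nu> (\<lambda>y. y\<^sup>2)" "\<nu>.expectation (\<lambda>y. y) = 0" "\<nu>.expectation (\<lambda>y. y\<^sup>2) = noise_var"
    using \<eta>_sq \<eta>_mean by (simp_all add: \<nu>_def integrable_distr_eq integral_distr noise_var_def)
  then obtain F where F[measurable]: "F \<in> borel_measurable borel" and F_cont: "isCont F 0"
    and F0: "F 0 = of_real (- noise_var / 2)" and F_char: "\<And>a. char \<nu> a = 1 + of_real (a\<^sup>2) * F a"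
    and F_le: "\<And>a. norm (F a) \<le> 3 / 2 * noise_var"
    using \<nu>.char_second_order by metis
  have noise_var: "noise_var \<ge> 0" by (simp add: noise_var_def)
  define r where "r n = sqrt (real n * h n)" for n
  define z where "z n = P.expectation (\<lambda>s. char \<nu> (t * k ((X s - x) / h n) * \<tau> (X s) / r n))" for n
  define c where "c = - (t\<^sup>2 * ((LINT u|lborel. (k u)\<^sup>2) * (\<tau> x)\<^sup>2 * f x * noise_var) / 2)"
  \<comment> \<open>The integrand of \<open>n * (z n - 1)\<close> after substitution: the factor
    \<open>n h\<close> cancels the \<open>1 / (r n)\<^sup>2\<close> contained in the squared
    argument of the characteristic function.\<close>
  define q where "q n u = complex_of_real (t\<^sup>2 * ((k u)\<^sup>2 * ((\<tau> (x + h n * u))\<^sup>2 * f (x + h n * u))))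
      * F (t * k u * \<tau> (x + h n * u) / r n)" for n u
  have char_eq: "char (distr M borel (knoise k n)) t = z n ^ n" for n
  proof -
    define W where "W i s = k ((Xs i s - x) / h n) * Gs i s / r n" for i s
    have [measurable]: "W i \<in> borel_measurable M" for i unfolding W_def by measurable
    have "knoise k n = (\<lambda>s. \<Sum>i<n. W i s)"
      by (simp add: fun_eq_iff knoise_def W_def r_def sum_divide_distrib)
    moreover have "indep_vars (\<lambda>_. borel) W {..<n}"
      unfolding W_def
      by (rule indep_vars_subset[OF indep_vars_compose2[OF sample_indep,
          of "\<lambda>_ (t, y). k ((t - x) / h n) * y / r n", simplified]]) auto
    moreover have "char (distr M borel (W i)) t = z n" for i
    proof -
      have "char (distr M borel (W i)) t = expectation (\<lambda>s. iexp (t * W i s))"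
        by (simp add: char_def integral_distr)
      also have "\<dots> = P.expectation (\<lambda>s. iexp (t * (k ((X s - x) / h n) * (\<tau> (X s) * \<eta> s) / r n)))"
        unfolding W_def
        by (rule sample_expectation[of "\<lambda>u y. iexp (t * (k ((u - x) / h n) * y / r n))"]) measurable
      also have "\<dots> = z n"
        using expectation_iexp_mult[of "\<lambda>u. t * k ((u - x) / h n) * \<tau> u / r n"]
        by (simp add: z_def \<nu>_def mult_ac)
      finally show ?thesis .
    qed
    ultimately show ?thesis
      by (simp add: char_distr_sum)
  qed
  have z_le: "norm (z n) \<le> 1" for n
  proof -
    have "norm (z n) \<le> P.expectation (\<lambda>s. norm (char \<nu> (t * k ((X s - x) / h n) * \<tau> (X s) / r n)))"
      unfolding z_def by (rule integral_norm_bound)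
    also have "\<dots> \<le> 1"
      by (intro P.integral_le_const P.integrable_const_bound[of _ 1] AE_I2)
        (auto intro: \<nu>.cmod_char_le_1)
    finally show ?thesis .
  qed
  have r: "(r n)\<^sup>2 = real n * h n" for n
    using h_pos[of n] by (simp add: r_def)
  \<comment> \<open>For \<open>n = 0\<close> the normaliser \<open>r n\<close> is 0 and the
    cancellation fails, hence the restriction to positive \<open>n\<close>.\<close>
  have z_eq: "of_nat n * (z n - 1) = (LINT u|lborel. q n u)" if n: "n > 0" for n
  proof -
    have r0: "r n \<noteq> 0" using n h_pos[of n] by (simp add: r_def)
    have "z n - 1 = P.expectation (\<lambda>s. char \<nu> (t * k ((X s - x) / h n) * \<tau> (X s) / r n) - 1)"
      unfolding z_def
      by (subst Bochner_Integration.integral_diff)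
        (auto intro!: P.integrable_const_bound[of _ 1] \<nu>.cmod_char_le_1 simp: P.prob_space)
    also have "\<dots> = h n *\<^sub>R (LINT u|lborel. f (x + h n * u) *\<^sub>R
        (char \<nu> (t * k u * \<tau> (x + h n * u) / r n) - 1))"
      by (rule local_integral[of "\<lambda>u y. char \<nu> (t * k u * \<tau> y / r n) - 1"]) measurable
    finally have "of_nat n * (z n - 1) = (real n * h n) *\<^sub>R (LINT u|lborel. f (x + h n * u) *\<^sub>R
        (char \<nu> (t * k u * \<tau> (x + h n * u) / r n) - 1))"
      by (simp add: scaleR_conv_of_real)
    also have "\<dots> = (LINT u|lborel. (r n)\<^sup>2 *\<^sub>R (f (x + h n * u) *\<^sub>R
        (char \<nu> (t * k u * \<tau> (x + h n * u) / r n) - 1)))"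
      by (simp only: r integral_scaleR_right)
    also have "\<dots> = (LINT u|lborel. q n u)"
      using r0 unfolding q_def F_char
      by (intro Bochner_Integration.integral_cong)
        (simp_all add: scaleR_conv_of_real power_divide power_mult_distrib)
    finally show ?thesis .
  qed
  have r_lim: "(\<lambda>n. 1 / r n) \<longlonglongrightarrow> 0"
    using tendsto_real_sqrt[OF inverse_nh_lim] by (simp add: r_def real_sqrt_divide)
  have "(\<lambda>n. LINT u|lborel. q n u) \<longlonglongrightarrow> (LINT u|lborel. complex_of_real (t\<^sup>2 * ((k u)\<^sup>2 * ((\<tau> x)\<^sup>2 * f x))) * F 0)"
  proof (rule integral_tendsto_dominated_eventually)
    show "(\<lambda>n. q n u) \<longlonglongrightarrow> complex_of_real (t\<^sup>2 * ((k u)\<^sup>2 * ((\<tau> x)\<^sup>2 * f x))) * F 0" for u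
      unfolding q_def
    proof (intro tendsto_mult tendsto_of_real tendsto_const tendsto_power
        tendsto_affine_arg[OF \<tau>_cont h_lim] tendsto_affine_arg[OF f_cont h_lim])
      have "(\<lambda>n. t * k u * \<tau> (x + h n * u) * (1 / r n)) \<longlonglongrightarrow> t * k u * \<tau> x * 0"
        by (intro tendsto_mult tendsto_const tendsto_affine_arg[OF \<tau>_cont h_lim] r_lim)
      then show "(\<lambda>n. F (t * k u * \<tau> (x + h n * u) / r n)) \<longlonglongrightarrow> F 0"
        by (intro isCont_tendsto_compose[OF F_cont]) simp
    qed
    \<comment> \<open>On the kernel support the variance density \<open>\<tau>\<^sup>2 * f\<close>
      eventually exceeds its value at \<open>x\<close> by at most 1, and \<open>F\<close> is bounded
      by \<open>3 / 2 * noise_var\<close>.\<close>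
    show "integrable lborel (\<lambda>u. t\<^sup>2 * ((k u)\<^sup>2 * ((\<tau> x)\<^sup>2 * f x + 1)) * (3 / 2 * noise_var))"
      using k2 by (simp add: kernel_like_def)
    show "\<forall>\<^sub>F n in sequentially. \<forall>u\<in>space lborel.
        norm (q n u) \<le> t\<^sup>2 * ((k u)\<^sup>2 * ((\<tau> x)\<^sup>2 * f x + 1)) * (3 / 2 * noise_var)"
      using eventually_bounded_on_support[OF k \<rho>_cont h_lim]
    proof eventually_elim
      case (elim n)
      have "norm (q n u) \<le> t\<^sup>2 * ((k u)\<^sup>2 * ((\<tau> x)\<^sup>2 * f x + 1)) * (3 / 2 * noise_var)" for u
      proof -
        have "(k u)\<^sup>2 * ((\<tau> (x + h n * u))\<^sup>2 * f (x + h n * u)) \<le> (k u)\<^sup>2 * ((\<tau> x)\<^sup>2 * f x + 1)"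
          using elim[rule_format, of u] f_nonneg by (cases "k u = 0") (auto simp: mult_left_mono)
        then have le: "t\<^sup>2 * ((k u)\<^sup>2 * ((\<tau> (x + h n * u))\<^sup>2 * f (x + h n * u))) \<le> t\<^sup>2 * ((k u)\<^sup>2 * ((\<tau> x)\<^sup>2 * f x + 1))"
          by (simp add: mult_left_mono)
        have "norm (q n u) = t\<^sup>2 * ((k u)\<^sup>2 * ((\<tau> (x + h n * u))\<^sup>2 * f (x + h n * u)))
            * norm (F (t * k u * \<tau> (x + h n * u) / r n))"
          unfolding q_def norm_mult[of "complex_of_real _" "F _"] norm_of_real
          using f_nonneg by (simp only: abs_of_nonneg mult_nonneg_nonneg zero_le_power2)
        also have "\<dots> \<le> t\<^sup>2 * ((k u)\<^sup>2 * ((\<tau> x)\<^sup>2 * f x + 1)) * (3 / 2 * noise_var)"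
          using f_nonneg by (intro mult_mono le F_le) auto
        finally show ?thesis .
      qed
      then show ?case by blast
    qed
  qed (use F in \<open>auto simp: q_def\<close>)
  also have "(LINT u|lborel. complex_of_real (t\<^sup>2 * ((k u)\<^sup>2 * ((\<tau> x)\<^sup>2 * f x))) * F 0) = of_real c"
  proof -
    have "(LINT u|lborel. complex_of_real (t\<^sup>2 * ((k u)\<^sup>2 * ((\<tau> x)\<^sup>2 * f x))) * F 0) =
        (LINT u|lborel. complex_of_real (t\<^sup>2 * ((k u)\<^sup>2 * ((\<tau> x)\<^sup>2 * f x)) * (- noise_var / 2)))"
      unfolding F0 by simp
    also have "\<dots> = of_real (LINT u|lborel. t\<^sup>2 * ((k u)\<^sup>2 * ((\<tau> x)\<^sup>2 * f x)) * (- noise_var / 2))"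
      by (rule integral_complex_of_real)
    also have "(LINT u|lborel. t\<^sup>2 * ((k u)\<^sup>2 * ((\<tau> x)\<^sup>2 * f x)) * (- noise_var / 2)) = c"
      by (simp add: c_def)
    finally show ?thesis .
  qed
  finally have "(\<lambda>n. LINT u|lborel. q n u) \<longlonglongrightarrow> of_real c" .
  then have "(\<lambda>n. of_nat n * (z n - 1)) \<longlonglongrightarrow> of_real c"
    by (rule Lim_transform_eventually) (use eventually_gt_at_top[of 0] in eventually_elim, simp add: z_eq)
  moreover have "c \<le> 0"
    using noise_var f_nonneg by (simp add: c_def)
  ultimately show ?thesis
    unfolding char_eq c_def[symmetric] by (intro tendsto_power_exp z_le)
qed

end

subsection \<open>The local linear estimator\<close>

text \<open>For \<open>v = 0\<close> the law is the point mass at 0; for \<open>v > 0\<close> it is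
  the image of the standard normal law under multiplication by \<open>sqrt v\<close>.\<close>

lemma
  assumes v: "v \<ge> 0"
  shows real_distribution_normal_law: "real_distribution (normal_law 0 v)"
    and char_normal_law: "char (normal_law 0 v) t = of_real (exp (- (t\<^sup>2 * v / 2)))"
proof -
  have "real_distribution (normal_law 0 v) \<and> char (normal_law 0 v) t = of_real (exp (- (t\<^sup>2 * v / 2)))"
  proof (cases "v = 0")
    case True
    then show ?thesis
      by (auto simp: normal_law_def real_distribution_def real_distribution_axioms_def char_def
          integral_return intro!: prob_space_return)
  next
    case False
    interpret S: real_distribution std_normal_distribution by (rule real_dist_normal_dist)
    have "distributed std_normal_distribution lborel (\<lambda>y. y) (\<lambda>y. ennreal (std_normal_density y))"
      by (simp add: distributed_def distr_id2)
    then have "distributed std_normal_distribution lborel (\<lambda>y. 0 + sqrt v * y)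
        (normal_density (0 + sqrt v * 0) (\<bar>sqrt v\<bar> * 1))"
      using False v by (intro S.normal_density_affine) auto
    then have "distr std_normal_distribution lborel (\<lambda>y. sqrt v * y) = normal_law 0 v"
      using False v by (simp add: distributed_def normal_law_def)
    then have eq: "normal_law 0 v = distr std_normal_distribution borel (\<lambda>y. sqrt v * y)"
      by (simp cong: distr_cong)
    have "char (normal_law 0 v) t = char std_normal_distribution (t * sqrt v)"
      unfolding eq by (simp add: char_def integral_distr mult.assoc)
    then show ?thesis
      using v S.real_distribution_distr[of "\<lambda>y. sqrt v * y"]
      by (simp add: char_std_normal_distribution eq power_mult_distrib)
  qed
  then show "real_distribution (normal_law 0 v)"
    "char (normal_law 0 v) t = of_real (exp (- (t\<^sup>2 * v / 2)))" by auto
qed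

section \<open>Algebra of the local linear weights\<close>

text \<open>Distances are measured in units of \<open>h\<close>, so that for \<open>r = 1\<close>
  the moments of all orders \<open>j\<close> have nondegenerate scale. The argument \<open>r\<close>
  also admits responses, remainders and noise.\<close>

definition kernel_moment :: "(real \<Rightarrow> real) \<Rightarrow> real \<Rightarrow> real \<Rightarrow> nat \<Rightarrow> (nat \<Rightarrow> real) \<Rightarrow> (nat \<Rightarrow> real) \<Rightarrow> nat \<Rightarrow> real" where
  "kernel_moment K h x n xs r j =
    (\<Sum>i<n. K ((xs i - x) / h) * ((xs i - x) / h) ^ j * r i) / (real n * h)"

lemma mu_hat_eq:
  assumes "h > 0"
  shows "mu_hat K h x n xs j = h ^ j * kernel_moment K h x n xs (\<lambda>_. 1) j"
proof -
  have "mu_hat K h x n xs j = (\<Sum>i<n. h ^ j * (K ((xs i - x) / h) * ((xs i - x) / h) ^ j) / h) / real n"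
    unfolding mu_hat_def scaled_kernel_def using assms
    by (intro arg_cong2[where f="(/)"] sum.cong) (auto simp: power_divide)
  also have "\<dots> = h ^ j * kernel_moment K h x n xs (\<lambda>_. 1) j"
    by (simp add: kernel_moment_def sum_distrib_left sum_divide_distrib mult_ac)
  finally show ?thesis .
qed

lemma sigma0_sq_hat_eq:
  fixes K :: "real \<Rightarrow> real" and xs :: "nat \<Rightarrow> real" and h x :: real and n :: nat
  assumes "h > 0"
  defines "A \<equiv> kernel_moment K h x n xs (\<lambda>_. 1)"
  shows "sigma0_sq_hat K h x n xs = h\<^sup>2 * (A 0 * A 2 - (A 1)\<^sup>2)"
  unfolding sigma0_sq_hat_def mu_hat_eq[OF assms(1)] A_def
  by (simp add: algebra_simps power2_eq_square)

text \<open>Cauchy-Schwarz for the vectors with entries \<open>sqrt (K d)\<close> and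
  \<open>sqrt (K d) * d\<close>, where \<open>d\<close> is the rescaled distance.\<close>

lemma sigma0_sq_hat_nonneg:
  assumes K: "\<And>u. K u \<ge> 0" and h: "h > 0"
  shows "sigma0_sq_hat K h x n xs \<ge> 0"
proof -
  let ?d = "\<lambda>i. (xs i - x) / h"
  have "(\<Sum>i<n. sqrt (K (?d i)) * (sqrt (K (?d i)) * ?d i))\<^sup>2 \<le>
      (\<Sum>i<n. (sqrt (K (?d i)))\<^sup>2) * (\<Sum>i<n. (sqrt (K (?d i)) * ?d i)\<^sup>2)"
    by (rule Cauchy_Schwarz_ineq_sum)
  then have "(\<Sum>i<n. K (?d i) * ?d i)\<^sup>2 \<le> (\<Sum>i<n. K (?d i)) * (\<Sum>i<n. K (?d i) * (?d i)\<^sup>2)"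
    using K by (simp only: power_mult_distrib real_sqrt_pow2 mult.assoc[symmetric] real_sqrt_mult_self abs_of_nonneg)
  then show ?thesis
    using h unfolding sigma0_sq_hat_eq[OF h] kernel_moment_def
    by (simp add: power_divide power2_eq_square divide_right_mono flip: diff_divide_distrib)
qed

text \<open>Since \<open>mu_hat\<close> of order \<open>j\<close> carries the factor
  \<open>h ^ j\<close>, numerator and denominator of the weights share \<open>h\<^sup>2\<close>, and
  only scale-free moments remain.\<close>

lemma local_frechet_inner:
  fixes K :: "real \<Rightarrow> real" and xs :: "nat \<Rightarrow> real" and h x :: real and n :: nat
    and ys :: "nat \<Rightarrow> 'a::real_inner" and w :: 'a
  assumes h: "h > 0" and pos: "sigma0_sq_hat K h x n xs > 0"
  defines "A \<equiv> kernel_moment K h x n xs (\<lambda>_. 1)"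
    and "B \<equiv> kernel_moment K h x n xs (\<lambda>i. ys i \<bullet> w)"
  shows "local_frechet K h x n xs ys \<bullet> w = (A 2 * B 0 - A 1 * B 1) / (A 0 * A 2 - (A 1)\<^sup>2)"
proof -
  let ?d = "\<lambda>i. (xs i - x) / h"
  let ?D = "A 0 * A 2 - (A 1)\<^sup>2"
  have weight: "ll_weight K h x n xs i = (A 2 * K (?d i) - A 1 * (K (?d i) * ?d i)) / (?D * h)" for i
  proof -
    have "ll_weight K h x n xs i = 1 / (h\<^sup>2 * ?D) * (K (?d i) / h) * (h\<^sup>2 * A 2 - h * A 1 * (xs i - x))"
      unfolding ll_weight_def sigma0_sq_hat_eq[OF h] mu_hat_eq[OF h] scaled_kernel_def A_def[symmetric]
      by simp
    also have "h\<^sup>2 * A 2 - h * A 1 * (xs i - x) = h\<^sup>2 * (A 2 - A 1 * ?d i)"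
      using h by (simp add: field_simps power2_eq_square)
    also have "1 / (h\<^sup>2 * ?D) * (K (?d i) / h) * (h\<^sup>2 * (A 2 - A 1 * ?d i)) =
        K (?d i) * (A 2 - A 1 * ?d i) / (?D * h)"
      using h by simp
    finally show ?thesis by (simp only: right_diff_distrib mult_ac)
  qed
  have "local_frechet K h x n xs ys \<bullet> w = (\<Sum>i<n. ll_weight K h x n xs i * (ys i \<bullet> w)) / real n"
    by (simp add: local_frechet_eq[OF pos] inner_sum_left divide_inverse mult.commute)
  also have "\<dots> = (\<Sum>i<n. A 2 * (K (?d i) * (ys i \<bullet> w)) - A 1 * (K (?d i) * ?d i * (ys i \<bullet> w))) / (?D * h) / real n"
    unfolding weight by (simp add: sum_divide_distrib algebra_simps)
  also have "\<dots> = (A 2 * B 0 - A 1 * B 1) / ?D"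
    unfolding B_def kernel_moment_def
    by (simp add: sum_subtractf sum_distrib_left[symmetric] diff_divide_distrib mult_ac)
  finally show ?thesis .
qed

text \<open>The local linear weights reproduce affine functions, so the affine part of the regression
  function contributes only its value at \<open>x\<close>.\<close>

lemma local_frechet_expansion:
  fixes K :: "real \<Rightarrow> real" and xs :: "nat \<Rightarrow> real" and h x :: real and n :: nat
    and ys :: "nat \<Rightarrow> 'a::real_inner" and w :: 'a
  assumes h: "h > 0" and pos: "sigma0_sq_hat K h x n xs > 0"
    and ys: "\<And>i. K ((xs i - x) / h) \<noteq> 0 \<Longrightarrow> ys i \<bullet> w = c0 + c1 * (xs i - x) + r i + g i"
  defines "A \<equiv> kernel_moment K h x n xs (\<lambda>_. 1)"
    and "R \<equiv> kernel_moment K h x n xs r" and "G \<equiv> kernel_moment K h x n xs g"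
  shows "local_frechet K h x n xs ys \<bullet> w - c0 =
    (A 2 * (R 0 + G 0) - A 1 * (R 1 + G 1)) / (A 0 * A 2 - (A 1)\<^sup>2)"
proof -
  let ?d = "\<lambda>i. (xs i - x) / h"
  have D: "A 0 * A 2 - (A 1)\<^sup>2 \<noteq> 0"
    using pos h unfolding sigma0_sq_hat_eq[OF h] A_def by auto
  have B: "kernel_moment K h x n xs (\<lambda>i. ys i \<bullet> w) j = c0 * A j + c1 * h * A (Suc j) + R j + G j" for j
  proof -
    have "K (?d i) * ?d i ^ j * (ys i \<bullet> w) =
        c0 * (K (?d i) * ?d i ^ j) + c1 * h * (K (?d i) * ?d i ^ Suc j) + K (?d i) * ?d i ^ j * r i
        + K (?d i) * ?d i ^ j * g i" for i
    proof (cases "K (?d i) = 0")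
      case False
      have "c1 * (xs i - x) = c1 * h * ?d i" using h by simp
      then show ?thesis unfolding ys[OF False] by (simp add: algebra_simps)
    qed simp
    then show ?thesis
      unfolding A_def R_def G_def kernel_moment_def
      by (simp add: sum.distrib sum_distrib_left[symmetric] add_divide_distrib del: power_Suc)
  qed
  \<comment> \<open>The slope contributes \<open>A 2 * A 1 - A 1 * A 2 = 0\<close>, while the
    intercept \<open>c0\<close> is multiplied by exactly the denominator.\<close>
  have "(A 2 * (c0 * A 0 + c1 * h * A 1 + R 0 + G 0) - A 1 * (c0 * A 1 + c1 * h * A 2 + R 1 + G 1)) =
      c0 * (A 0 * A 2 - (A 1)\<^sup>2) + (A 2 * (R 0 + G 0) - A 1 * (R 1 + G 1))"
    by (simp add: algebra_simps power2_eq_square)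
  then show ?thesis
    unfolding local_frechet_inner[OF h pos] B A_def[symmetric] using D
    by (simp add: add_divide_distrib numeral_2_eq_2)
qed

text \<open>Measurability of a minimiser is read off from explicit values. Where the denominator is
  not positive it is 0 by Cauchy-Schwarz, all weights vanish through division by zero, and the
  minimiser is one fixed element.\<close>

lemma local_frechet_inner_measurable:
  fixes Ys :: "nat \<Rightarrow> 'c \<Rightarrow> 'a::real_inner"
  assumes K: "\<And>u. K u \<ge> 0" and [measurable]: "K \<in> borel_measurable borel" and h: "h > 0"
    and [measurable]: "\<And>i. Xs i \<in> borel_measurable M" and Ys: "\<And>i. Ys i \<in> borel_measurable M"
  shows "(\<lambda>s. local_frechet K h x n (\<lambda>i. Xs i s) (\<lambda>i. Ys i s) \<bullet> w) \<in> borel_measurable M"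
proof -
  have [measurable]: "(\<lambda>s. Ys i s \<bullet> w) \<in> borel_measurable M" for i
    by (rule measurable_compose[OF Ys]) (intro borel_measurable_continuous_onI continuous_intros)
  define A where "A s = kernel_moment K h x n (\<lambda>i. Xs i s) (\<lambda>_. 1)" for s
  define B where "B s = kernel_moment K h x n (\<lambda>i. Xs i s) (\<lambda>i. Ys i s \<bullet> w)" for s
  have [measurable]: "(\<lambda>s. A s j) \<in> borel_measurable M" "(\<lambda>s. B s j) \<in> borel_measurable M" for j
    unfolding A_def B_def kernel_moment_def by measurable
  have eq: "local_frechet K h x n (\<lambda>i. Xs i s) (\<lambda>i. Ys i s) \<bullet> w =
    (if A s 0 * A s 2 - (A s 1)\<^sup>2 > 0 then (A s 2 * B s 0 - A s 1 * B s 1) / (A s 0 * A s 2 - (A s 1)\<^sup>2)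
     else (ARG_MIN (\<lambda>_::'a. 0::real) w. True) \<bullet> w)" for s
  proof (cases "A s 0 * A s 2 - (A s 1)\<^sup>2 > 0")
    case True
    then have "sigma0_sq_hat K h x n (\<lambda>i. Xs i s) > 0"
      using h by (simp add: sigma0_sq_hat_eq[OF h] A_def)
    then show ?thesis
      using True local_frechet_inner[OF h, of K x n "\<lambda>i. Xs i s" "\<lambda>i. Ys i s" w] by (simp add: A_def B_def)
  next
    case False
    have "sigma0_sq_hat K h x n (\<lambda>i. Xs i s) = 0"
      using False h sigma0_sq_hat_nonneg[of K h x n "\<lambda>i. Xs i s", OF K h]
      by (auto simp: sigma0_sq_hat_eq[OF h] A_def zero_le_mult_iff)
    then have "local_frechet K h x n (\<lambda>i. Xs i s) (\<lambda>i. Ys i s) = (ARG_MIN (\<lambda>_::'a. 0::real) w. True)"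
      by (simp add: local_frechet_def ll_weight_def)
    then show ?thesis using False by simp
  qed
  show ?thesis unfolding eq by measurable
qed

section \<open>Limit law of the projected estimator\<close>

context local_sample
begin

text \<open>The condition on \<open>n h ^ 5\<close> makes any term of order \<open>h\<^sup>2\<close>
  negligible at scale \<open>sqrt (n h)\<close>. This applies to the subtracted
  \<open>\<beta> * (h n)\<^sup>2\<close> for arbitrary \<open>\<beta>\<close> as well as to the
  Taylor remainder, and leaves \<open>knoise K / f x\<close>.\<close>

theorem local_frechet_weak_conv:
  fixes Ys :: "nat \<Rightarrow> 'c \<Rightarrow> 'a::real_inner" and K :: "real \<Rightarrow> real" and w :: 'a
  assumes Ys: "\<And>i. Ys i \<in> borel_measurable M"
    and f_pos: "f x > 0"
    and K_nonneg: "\<And>u. K u \<ge> 0" and K: "kernel_like K" and K2: "kernel_like (\<lambda>u. (K u)\<^sup>2)"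
    and K_int: "(LINT u|lborel. K u) = 1" and K_sym: "\<And>u. K (- u) = K u"
    and nh5: "(\<lambda>n. real n * h n ^ 5) \<longlonglongrightarrow> 0"
    and taylor: "\<forall>\<^sub>F n in sequentially. \<forall>i s. K ((Xs i s - x) / h n) \<noteq> 0 \<longrightarrow>
      \<bar>Ys i s \<bullet> w - c0 - c1 * (Xs i s - x) - Gs i s\<bar> \<le> L * (Xs i s - x)\<^sup>2"
  shows "weak_conv_m (\<lambda>n. distr M borel (\<lambda>s. sqrt (real n * h n) *
      (local_frechet K (h n) x n (\<lambda>i. Xs i s) (\<lambda>i. Ys i s) \<bullet> w - c0 - \<beta> * (h n)\<^sup>2)))
    (normal_law 0 ((LINT u|lborel. (K u)\<^sup>2) / f x * (\<tau> x)\<^sup>2 * noise_var))"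
proof -
  define \<kappa> where "\<kappa> j u = K u * u ^ j" for j :: nat and u :: real
  have \<kappa>: "kernel_like (\<kappa> j)" for j
    unfolding \<kappa>_def by (rule kernel_like_mult_power[OF K])
  have \<kappa>2: "kernel_like (\<lambda>u. (\<kappa> j u)\<^sup>2)" for j
    unfolding \<kappa>_def power_mult_distrib power_mult[symmetric] by (rule kernel_like_mult_power[OF K2])
  note [measurable] = kernel_like_measurable[OF K] kmean_measurable[OF \<kappa>] knoise_measurable[OF \<kappa>]
  define U where "U n s = sqrt (real n * h n) *
      (local_frechet K (h n) x n (\<lambda>i. Xs i s) (\<lambda>i. Ys i s) \<bullet> w - c0 - \<beta> * (h n)\<^sup>2)" for n s
  have [measurable]: "U n \<in> borel_measurable M" for n
    unfolding U_def
    by (intro borel_measurable_times borel_measurable_diff local_frechet_inner_measurable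
        K_nonneg h_pos Ys) auto
  define A where "A j = kmean (\<kappa> j)" for j
  define S where "S j = knoise (\<kappa> j)" for j
  define rt where "rt n = sqrt (real n * h n)" for n
  define r where "r s i = Ys i s \<bullet> w - c0 - c1 * (Xs i s - x) - Gs i s" for s i
  define R where "R j n s = rt n * kernel_moment K (h n) x n (\<lambda>i. Xs i s) (r s) j" for j n s
  define Q where "Q n s = A 0 n s * A 2 n s - (A 1 n s)\<^sup>2" for n s
  define \<mu>2 where "\<mu>2 = (LINT u|lborel. \<kappa> 2 u)"
  have [measurable]: "A j n \<in> borel_measurable M" "S j n \<in> borel_measurable M" for j n
    unfolding A_def S_def by measurable
  have [measurable]: "Q n \<in> borel_measurable M" for n
    unfolding Q_def by measurable

  have int0: "(LINT u|lborel. \<kappa> 0 u) = 1"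
    using K_int by (simp add: \<kappa>_def)
  have int1: "(LINT u|lborel. \<kappa> 1 u) = 0"
  proof -
    have "(LINT u|lborel. \<kappa> 1 u) = (LINT u|lborel. \<kappa> 1 (0 + (- 1) * u))"
      using lborel_integral_real_affine[of "- 1" "\<kappa> 1" 0] by simp
    also have "\<dots> = - (LINT u|lborel. \<kappa> 1 u)"
      by (simp add: \<kappa>_def K_sym)
    finally show ?thesis by simp
  qed
  \<comment> \<open>Otherwise \<open>K u * u\<^sup>2\<close>, and with it \<open>K\<close>, would
    vanish almost everywhere, against total mass 1. Positivity keeps the limit of the denominator
    \<open>Q\<close> away from 0.\<close>
  have \<mu>2_pos: "\<mu>2 > 0"
  proof -
    have "\<mu>2 \<ge> 0"
      unfolding \<mu>2_def \<kappa>_def using K_nonneg by (intro integral_nonneg_AE AE_I2) auto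
    moreover have "\<mu>2 \<noteq> 0"
    proof
      assume "\<mu>2 = 0"
      then have "AE u in lborel. \<kappa> 2 u = 0"
        unfolding \<mu>2_def using K_nonneg \<kappa>[of 2]
        by (subst (asm) integral_nonneg_eq_0_iff_AE) (auto simp: kernel_like_def \<kappa>_def)
      moreover have "AE u in lborel. u \<noteq> (0::real)"
        by (rule AE_lborel_singleton)
      ultimately have "AE u in lborel. K u = 0"
        by eventually_elim (simp add: \<kappa>_def)
      then have "(LINT u|lborel. K u) = 0"
        by (simp add: integral_eq_zero_AE)
      with K_int show False by simp
    qed
    ultimately show ?thesis by simp
  qed

  have A_lim: "((\<lambda>z. A j (fst z) (snd z)) \<longlongrightarrow> f x * (LINT u|lborel. \<kappa> j u)) (whp M)" for j
    using kmean_tendsto[OF \<kappa> \<kappa>2, of j] by (simp add: A_def case_prod_unfold)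
  have A0: "((\<lambda>z. A 0 (fst z) (snd z)) \<longlongrightarrow> f x) (whp M)"
    and A1: "((\<lambda>z. A 1 (fst z) (snd z)) \<longlongrightarrow> 0) (whp M)"
    and A2: "((\<lambda>z. A 2 (fst z) (snd z)) \<longlongrightarrow> f x * \<mu>2) (whp M)"
    using A_lim[of 0] A_lim[of 1] A_lim[of 2] int0 int1 by (simp_all add: \<mu>2_def)
  have Q_lim: "((\<lambda>z. Q (fst z) (snd z)) \<longlongrightarrow> f x * (f x * \<mu>2)) (whp M)"
    using tendsto_diff[OF tendsto_mult[OF A0 A2] tendsto_power[OF A1, of 2]] by (simp add: Q_def)
  have Q0: "f x * (f x * \<mu>2) > 0" using f_pos \<mu>2_pos by simp
  have A2Q: "((\<lambda>z. A 2 (fst z) (snd z) / Q (fst z) (snd z)) \<longlongrightarrow> 1 / f x) (whp M)"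
    using tendsto_divide[OF A2 Q_lim] Q0 f_pos \<mu>2_pos by simp
  have A1Q: "((\<lambda>z. A 1 (fst z) (snd z) / Q (fst z) (snd z)) \<longlongrightarrow> 0) (whp M)"
    using tendsto_divide[OF A1 Q_lim] f_pos \<mu>2_pos by simp

  have rt_h: "(\<lambda>n. rt n * (h n)\<^sup>2) \<longlonglongrightarrow> 0"
  proof -
    have "rt n * (h n)\<^sup>2 = sqrt (real n * h n ^ 5)" for n
      using h_pos[of n] by (simp add: rt_def real_sqrt_mult power_numeral_reduce[of "h n"] power2_eq_square)
    then show ?thesis
      using tendsto_real_sqrt[OF nh5] by simp
  qed
  have rt_h_whp: "((\<lambda>z. rt (fst z) * (h (fst z))\<^sup>2) \<longlongrightarrow> 0) (whp M)"
    using tendsto_whp_of_seq[OF rt_h] by (simp add: case_prod_unfold)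

  \<comment> \<open>The quadratic remainder bound supplies a factor \<open>(h n)\<^sup>2\<close> and
    two more powers of the rescaled distance. Hence \<open>R j\<close> is dominated by
    \<open>rt n * (h n)\<^sup>2\<close>, which tends to 0, times a kernel average that converges in
    probability.\<close>
  have R_lim: "((\<lambda>z. R j (fst z) (snd z)) \<longlongrightarrow> 0) (whp M)" for j
  proof -
    let ?k = "\<lambda>u. \<bar>\<kappa> (j + 2) u\<bar>"
    have "((\<lambda>z. kmean ?k (fst z) (snd z)) \<longlongrightarrow> f x * (LINT u|lborel. ?k u)) (whp M)"
      using kmean_tendsto[of ?k] kernel_like_abs[OF \<kappa>[of "j + 2"]] \<kappa>2[of "j + 2"]
      by (simp add: case_prod_unfold)
    from tendsto_mult[OF tendsto_mult[OF tendsto_const[of L] rt_h_whp] this]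
    have bound: "((\<lambda>z. L * (rt (fst z) * (h (fst z))\<^sup>2) * kmean ?k (fst z) (snd z)) \<longlongrightarrow> 0) (whp M)"
      by simp
    have ev: "\<forall>\<^sub>F z in whp M. \<forall>i s. K ((Xs i s - x) / h (fst z)) \<noteq> 0 \<longrightarrow> \<bar>r s i\<bar> \<le> L * (Xs i s - x)\<^sup>2"
      using eventually_compose_filterlim[OF taylor filterlim_fst_whp] by (simp add: r_def)
    show ?thesis
    proof (rule Lim_null_comparison[OF _ bound], use ev in eventually_elim)
      fix z :: "nat \<times> 'c"
      assume r_le: "\<forall>i s. K ((Xs i s - x) / h (fst z)) \<noteq> 0 \<longrightarrow> \<bar>r s i\<bar> \<le> L * (Xs i s - x)\<^sup>2"
      obtain n s where z: "z = (n, s)" by (cases z)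
      let ?d = "\<lambda>i. (Xs i s - x) / h n"
      have term_le: "\<bar>K (?d i) * ?d i ^ j * r s i\<bar> \<le> L * (h n)\<^sup>2 * \<bar>\<kappa> (j + 2) (?d i)\<bar>" for i
      proof (cases "K (?d i) = 0")
        case False
        have "\<bar>K (?d i) * ?d i ^ j * r s i\<bar> \<le> \<bar>K (?d i) * ?d i ^ j\<bar> * (L * (Xs i s - x)\<^sup>2)"
          using r_le False by (simp add: z abs_mult mult_left_mono)
        also have "L * (Xs i s - x)\<^sup>2 = L * (h n)\<^sup>2 * \<bar>?d i ^ 2\<bar>"
          using h_pos[of n] by (simp add: power_divide)
        also have "\<bar>K (?d i) * ?d i ^ j\<bar> * (L * (h n)\<^sup>2 * \<bar>?d i ^ 2\<bar>) = L * (h n)\<^sup>2 * \<bar>\<kappa> (j + 2) (?d i)\<bar>"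
          by (simp only: \<kappa>_def power_add abs_mult mult_ac)
        finally show ?thesis .
      qed (simp add: \<kappa>_def)
      have "\<bar>\<Sum>i<n. K (?d i) * ?d i ^ j * r s i\<bar> \<le> (\<Sum>i<n. L * (h n)\<^sup>2 * \<bar>\<kappa> (j + 2) (?d i)\<bar>)"
        by (rule order_trans[OF sum_abs sum_mono]) (rule term_le)
      then have "\<bar>kernel_moment K (h n) x n (\<lambda>i. Xs i s) (r s) j\<bar> \<le> L * (h n)\<^sup>2 * kmean ?k n s"
        using h_pos[of n]
        by (simp add: kernel_moment_def kmean_def abs_divide divide_right_mono flip: sum_distrib_left)
      then have "rt n * \<bar>kernel_moment K (h n) x n (\<lambda>i. Xs i s) (r s) j\<bar> \<le> rt n * (L * (h n)\<^sup>2 * kmean ?k n s)"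
        using h_pos[of n] by (intro mult_left_mono) (auto simp: rt_def less_imp_le)
      then show "norm (R j (fst z) (snd z)) \<le> L * (rt (fst z) * (h (fst z))\<^sup>2) * kmean ?k (fst z) (snd z)"
        using h_pos[of n] by (simp add: z R_def abs_mult rt_def less_imp_le mult_ac)
    qed
  qed

  \<comment> \<open>The identity is exact on the event that the denominator is positive, whose
    probability tends to 1 because \<open>Q\<close> has a positive limit.\<close>
  have rep: "\<forall>\<^sub>F z in whp M. U (fst z) (snd z) =
      (A 2 (fst z) (snd z) * (R 0 (fst z) (snd z) + S 0 (fst z) (snd z))
        - A 1 (fst z) (snd z) * (R 1 (fst z) (snd z) + S 1 (fst z) (snd z))) / Q (fst z) (snd z)
      - \<beta> * (rt (fst z) * (h (fst z))\<^sup>2)"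
    using order_tendstoD(1)[OF Q_lim Q0]
      eventually_compose_filterlim[OF eventually_gt_at_top[of 0] filterlim_fst_whp]
  proof eventually_elim
    fix z :: "nat \<times> 'c"
    assume Q: "0 < Q (fst z) (snd z)" and n: "0 < fst z"
    obtain n s where z: "z = (n, s)" by (cases z)
    let ?xs = "\<lambda>i. Xs i s"
    have nh: "real n * h n > 0" using n h_pos[of n] by (simp add: z)
    have A_eq: "kernel_moment K (h n) x n ?xs (\<lambda>_. 1) j = A j n s" for j
      by (simp add: kernel_moment_def A_def kmean_def \<kappa>_def)
    have S_eq: "rt n * kernel_moment K (h n) x n ?xs (\<lambda>i. Gs i s) j = S j n s" for j
    proof -
      let ?\<Sigma> = "\<Sum>i<n. K ((Xs i s - x) / h n) * ((Xs i s - x) / h n) ^ j * Gs i s"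
      have rt: "real n * h n = rt n * rt n" "rt n \<noteq> 0"
        using nh n by (auto simp: rt_def z)
      have "rt n * kernel_moment K (h n) x n ?xs (\<lambda>i. Gs i s) j = rt n * (?\<Sigma> / (rt n * rt n))"
        by (simp only: kernel_moment_def rt(1))
      also have "\<dots> = ?\<Sigma> / rt n"
        using rt(2) by simp
      also have "\<dots> = S j n s"
        by (simp add: S_def knoise_def \<kappa>_def rt_def)
      finally show ?thesis .
    qed
    have pos: "sigma0_sq_hat K (h n) x n ?xs > 0"
      using Q h_pos[of n] by (simp add: sigma0_sq_hat_eq[OF h_pos] A_eq z Q_def)
    have "local_frechet K (h n) x n ?xs (\<lambda>i. Ys i s) \<bullet> w - c0 =
      (A 2 n s * (kernel_moment K (h n) x n ?xs (r s) 0 + kernel_moment K (h n) x n ?xs (\<lambda>i. Gs i s) 0)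
       - A 1 n s * (kernel_moment K (h n) x n ?xs (r s) 1 + kernel_moment K (h n) x n ?xs (\<lambda>i. Gs i s) 1))
      / Q n s"
      using local_frechet_expansion[OF h_pos pos, of "\<lambda>i. Ys i s" w c0 c1 "r s" "\<lambda>i. Gs i s"]
      by (simp add: r_def[abs_def] A_eq Q_def)
    then have "U n s = rt n * ((A 2 n s * (kernel_moment K (h n) x n ?xs (r s) 0 + kernel_moment K (h n) x n ?xs (\<lambda>i. Gs i s) 0)
       - A 1 n s * (kernel_moment K (h n) x n ?xs (r s) 1 + kernel_moment K (h n) x n ?xs (\<lambda>i. Gs i s) 1))
      / Q n s - \<beta> * (h n)\<^sup>2)"
      by (simp add: U_def rt_def)
    also have "\<dots> = (A 2 n s * (R 0 n s + S 0 n s) - A 1 n s * (R 1 n s + S 1 n s)) / Q n s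
        - \<beta> * (rt n * (h n)\<^sup>2)"
      unfolding R_def S_eq[symmetric] by (simp add: algebra_simps)
    finally show "U (fst z) (snd z) =
      (A 2 (fst z) (snd z) * (R 0 (fst z) (snd z) + S 0 (fst z) (snd z))
        - A 1 (fst z) (snd z) * (R 1 (fst z) (snd z) + S 1 (fst z) (snd z))) / Q (fst z) (snd z)
      - \<beta> * (rt (fst z) * (h (fst z))\<^sup>2)"
      by (simp add: z)
  qed

  obtain C0 where C0: "\<forall>\<^sub>F n in sequentially. integrable M (\<lambda>s. (S 0 n s)\<^sup>2) \<and> expectation (\<lambda>s. (S 0 n s)\<^sup>2) \<le> C0"
    using knoise_L2_bounded[OF \<kappa> \<kappa>2] unfolding S_def by blast
  obtain C1 where C1: "\<forall>\<^sub>F n in sequentially. integrable M (\<lambda>s. (S 1 n s)\<^sup>2) \<and> expectation (\<lambda>s. (S 1 n s)\<^sup>2) \<le> C1"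
    using knoise_L2_bounded[OF \<kappa> \<kappa>2] unfolding S_def by blast
  \<comment> \<open>Replaces the random coefficient \<open>A 2 / Q\<close> by its limit
    \<open>1 / f x\<close>: the error is a factor tending to 0 in probability times one bounded in
    second moment.\<close>
  have S0: "((\<lambda>z. (A 2 (fst z) (snd z) / Q (fst z) (snd z) - 1 / f x) * S 0 (fst z) (snd z)) \<longlongrightarrow> 0) (whp M)"
    using tendsto_whp_mult_L2_bounded[of "\<lambda>n s. A 2 n s / Q n s - 1 / f x" "S 0", OF _ _ _ C0]
      LIM_zero[OF A2Q] by (simp add: case_prod_unfold)
  have S1: "((\<lambda>z. (A 1 (fst z) (snd z) / Q (fst z) (snd z)) * S 1 (fst z) (snd z)) \<longlongrightarrow> 0) (whp M)"
    using tendsto_whp_mult_L2_bounded[of "\<lambda>n s. A 1 n s / Q n s" "S 1", OF _ _ _ C1]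
      A1Q by (simp add: case_prod_unfold)
  have "((\<lambda>z. ((A 2 (fst z) (snd z) / Q (fst z) (snd z) - 1 / f x) * S 0 (fst z) (snd z)
      - A 1 (fst z) (snd z) / Q (fst z) (snd z) * S 1 (fst z) (snd z)
      + (A 2 (fst z) (snd z) / Q (fst z) (snd z) * R 0 (fst z) (snd z)
      - A 1 (fst z) (snd z) / Q (fst z) (snd z) * R 1 (fst z) (snd z)))
      - \<beta> * (rt (fst z) * (h (fst z))\<^sup>2)) \<longlongrightarrow> 0 - 0 + (1 / f x * 0 - 0 * 0) - \<beta> * 0) (whp M)"
    by (intro tendsto_diff tendsto_add tendsto_mult[OF tendsto_const rt_h_whp] S0 S1
        tendsto_mult[OF A2Q R_lim] tendsto_mult[OF A1Q R_lim])
  then have lim: "((\<lambda>z. U (fst z) (snd z) - S 0 (fst z) (snd z) / f x) \<longlongrightarrow> 0) (whp M)"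
  proof (rule Lim_transform_eventually[of _ "_ :: real", THEN tendsto_eq_rhs])
    show "\<forall>\<^sub>F z in whp M. ((A 2 (fst z) (snd z) / Q (fst z) (snd z) - 1 / f x) * S 0 (fst z) (snd z)
      - A 1 (fst z) (snd z) / Q (fst z) (snd z) * S 1 (fst z) (snd z)
      + (A 2 (fst z) (snd z) / Q (fst z) (snd z) * R 0 (fst z) (snd z)
      - A 1 (fst z) (snd z) / Q (fst z) (snd z) * R 1 (fst z) (snd z)))
      - \<beta> * (rt (fst z) * (h (fst z))\<^sup>2) = U (fst z) (snd z) - S 0 (fst z) (snd z) / f x"
      using rep by eventually_elim (simp add: diff_divide_distrib add_divide_distrib algebra_simps)
  qed simp

  let ?V = "(LINT u|lborel. (K u)\<^sup>2) / f x * (\<tau> x)\<^sup>2 * noise_var"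
  have V: "?V \<ge> 0"
    using f_nonneg[of x] by (simp add: noise_var_def)
  have "weak_conv_m (\<lambda>n. distr M borel (U n)) (normal_law 0 ?V)"
  proof (rule weak_conv_m_of_whp)
    show "((\<lambda>(n, s). U n s - S 0 n s / f x) \<longlongrightarrow> 0) (whp M)"
      using lim by (simp add: case_prod_unfold)
    show "real_distribution (normal_law 0 ?V)"
      by (rule real_distribution_normal_law[OF V])
    fix t
    \<comment> \<open>Dividing by \<open>f x\<close> rescales the argument, which turns the factor
      \<open>f x\<close> in the variance of the noise sum into \<open>1 / f x\<close>.\<close>
    have "char (distr M borel (\<lambda>s. S 0 n s / f x)) t = char (distr M borel (S 0 n)) (t / f x)" for n
      by (simp add: char_def integral_distr)
    moreover have "S 0 = knoise K"
      by (simp add: S_def \<kappa>_def[abs_def])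
    moreover have "(t / f x)\<^sup>2 * ((LINT u|lborel. (K u)\<^sup>2) * (\<tau> x)\<^sup>2 * f x * noise_var) / 2 = t\<^sup>2 * ?V / 2"
      using f_pos by (simp add: field_simps power2_eq_square)
    ultimately show "(\<lambda>n. char (distr M borel (\<lambda>s. S 0 n s / f x)) t) \<longlonglongrightarrow> char (normal_law 0 ?V) t"
      using knoise_char_tendsto[OF K K2, of "t / f x"] by (simp only: char_normal_law[OF V])
  qed measurable
  then show ?thesis by (simp only: U_def[abs_def])
qed

end

subsection \<open>Asymptotic normality\<close>

text \<open>The second derivative is continuous, hence bounded on a compact ball inside
  \<open>N\<close>; the Lagrange form of the remainder gives the estimate.\<close>

lemma taylor_quadratic_bound:
  fixes \<phi> :: "real \<Rightarrow> real"
  assumes N: "open N" "x \<in> N" and \<phi>: "\<phi> C1_differentiable_on N" "deriv \<phi> C1_differentiable_on N"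
  obtains d L where "d > 0"
    "\<And>t. \<bar>t - x\<bar> \<le> d \<Longrightarrow> t \<in> N \<and> \<bar>\<phi> t - \<phi> x - deriv \<phi> x * (t - x)\<bar> \<le> L * (t - x)\<^sup>2"
proof -
  obtain D where "\<forall>t\<in>N. (deriv \<phi> has_vector_derivative D t) (at t)" and D_cont: "continuous_on N D"
    using \<phi>(2) by (auto simp: C1_differentiable_on_def)
  then have D: "(deriv \<phi> has_real_derivative D t) (at t)" if "t \<in> N" for t
    using that by (simp add: has_real_derivative_iff_has_vector_derivative)
  have deriv: "(\<phi> has_real_derivative deriv \<phi> t) (at t)" if "t \<in> N" for t
  proof -
    obtain D' where "\<forall>t\<in>N. (\<phi> has_vector_derivative D' t) (at t)"
      using \<phi>(1) by (auto simp: C1_differentiable_on_def)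
    then have "(\<phi> has_real_derivative D' t) (at t)"
      using that by (simp add: has_real_derivative_iff_has_vector_derivative)
    with DERIV_imp_deriv[OF this] show ?thesis by simp
  qed
  obtain d where d: "d > 0" "cball x d \<subseteq> N"
    using N open_contains_cball by blast
  have "compact (D ` cball x d)"
    using D_cont d(2) by (intro compact_continuous_image) (auto intro: continuous_on_subset)
  then obtain B where "\<forall>y\<in>D ` cball x d. norm y \<le> B"
    using compact_imp_bounded bounded_iff by blast
  then have B: "\<bar>D t\<bar> \<le> B" if "t \<in> cball x d" for t
    using that by auto
  have in_cball: "t \<in> cball x d \<longleftrightarrow> x - d \<le> t \<and> t \<le> x + d" for t
    by (auto simp: dist_real_def)
  have "t \<in> N \<and> \<bar>\<phi> t - \<phi> x - deriv \<phi> x * (t - x)\<bar> \<le> B / 2 * (t - x)\<^sup>2" if t: "\<bar>t - x\<bar> \<le> d" for t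
  proof
    show "t \<in> N" using d t in_cball[of t] by auto
    show "\<bar>\<phi> t - \<phi> x - deriv \<phi> x * (t - x)\<bar> \<le> B / 2 * (t - x)\<^sup>2"
    proof (cases "t = x")
      case False
      define diff where "diff j = (if j = 0 then \<phi> else if j = 1 then deriv \<phi> else D)" for j :: nat
      have "\<exists>\<xi>. (if t < x then t < \<xi> \<and> \<xi> < x else x < \<xi> \<and> \<xi> < t) \<and>
          \<phi> t = (\<Sum>j<2. (diff j x / fact j) * (t - x) ^ j) + (diff 2 \<xi> / fact 2) * (t - x) ^ 2"
      proof (rule Taylor)
        show "\<forall>j s. j < 2 \<and> x - d \<le> s \<and> s \<le> x + d \<longrightarrow> DERIV (diff j) s :> diff (Suc j) s"
        proof (intro allI impI)
          fix j :: nat and s assume s: "j < 2 \<and> x - d \<le> s \<and> s \<le> x + d"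
          then have "s \<in> N" using in_cball d by auto
          then show "DERIV (diff j) s :> diff (Suc j) s"
            using s deriv D by (auto simp: diff_def less_2_cases_iff)
        qed
      qed (use False t d in \<open>auto simp: diff_def\<close>)
      then obtain \<xi> where \<xi>: "if t < x then t < \<xi> \<and> \<xi> < x else x < \<xi> \<and> \<xi> < t"
        and eq: "\<phi> t = (\<Sum>j<2. (diff j x / fact j) * (t - x) ^ j) + (diff 2 \<xi> / fact 2) * (t - x) ^ 2"
        by blast
      have "\<phi> t - \<phi> x - deriv \<phi> x * (t - x) = D \<xi> / 2 * (t - x)\<^sup>2"
        unfolding eq by (simp add: diff_def numeral_2_eq_2)
      then have "\<bar>\<phi> t - \<phi> x - deriv \<phi> x * (t - x)\<bar> = \<bar>D \<xi> / 2 * (t - x)\<^sup>2\<bar>"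
        by (simp only:)
      also have "\<dots> = \<bar>D \<xi>\<bar> / 2 * (t - x)\<^sup>2"
        by (simp add: abs_mult)
      also have "\<dots> \<le> B / 2 * (t - x)\<^sup>2"
      proof (intro mult_right_mono divide_right_mono B)
        show "\<xi> \<in> cball x d" unfolding in_cball using \<xi> t by (auto split: if_splits)
      qed auto
      finally show ?thesis .
    qed simp
  qed
  with d(1) show ?thesis by (rule that)
qed

lemma eventually_kernel_support_near:
  assumes k: "kernel_like k" and h: "\<And>n. h n > 0" "h \<longlonglongrightarrow> 0" and d: "d > 0"
  shows "\<forall>\<^sub>F n in sequentially. \<forall>t. k ((t - x) / h n) \<noteq> 0 \<longrightarrow> \<bar>t - x\<bar> \<le> d"
proof -
  obtain b where b: "b > 0" "\<And>u. k u \<noteq> 0 \<Longrightarrow> \<bar>u\<bar> \<le> b"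
    using kernel_like_support[OF k] by blast
  have "\<forall>\<^sub>F n in sequentially. \<bar>h n\<bar> < d / b"
    using tendstoD[OF h(2), of "d / b"] b d by simp
  then show ?thesis
  proof eventually_elim
    case (elim n)
    show ?case
    proof (intro allI impI)
      fix t assume "k ((t - x) / h n) \<noteq> 0"
      from b(2)[OF this] have "\<bar>t - x\<bar> \<le> b * h n"
        using h(1)[of n] by (simp add: abs_divide field_simps)
      also have "\<dots> \<le> d" using elim h(1)[of n] b(1) by (simp add: field_simps)
      finally show "\<bar>t - x\<bar> \<le> d" .
    qed
  qed
qed

text \<open>The sigma-algebra generated by \<open>g\<close> of \<open>Z\<close> is contained in the
  one generated by \<open>Z\<close>. This passes from independence of \<open>X\<close> and the
  Hilbert-valued noise, stated for sigma-algebras, to independence of two real variables.\<close>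

lemma (in prob_space) indep_var_compose_vimage_algebra:
  assumes indep: "indep_set (sets (vimage_algebra (space M) X S)) (sets (vimage_algebra (space M) Z T))"
    and X: "random_variable S X" and Z: "random_variable T Z" and g: "g \<in> T \<rightarrow>\<^sub>M T'"
  shows "indep_var S X T' (\<lambda>s. g (Z s))"
  unfolding indep_var_eq
proof (intro conjI X measurable_compose[OF Z g])
  have sub: "sigma_sets (space M) {(\<lambda>s. g (Z s)) -` A \<inter> space M |A. A \<in> sets T'}
      \<subseteq> sets (vimage_algebra (space M) Z T)"
    unfolding sets_vimage_algebra
  proof (rule sigma_sets_mono, safe)
    fix A assume "A \<in> sets T'"
    then have "g -` A \<inter> space T \<in> sets T" by (rule measurable_sets[OF g])
    moreover have "(\<lambda>s. g (Z s)) -` A \<inter> space M = Z -` (g -` A \<inter> space T) \<inter> space M"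
      using measurable_space[OF Z] by auto
    ultimately show "(\<lambda>s. g (Z s)) -` A \<inter> space M
        \<in> sigma_sets (space M) {Z -` A \<inter> space M |A. A \<in> sets T}"
      by (intro sigma_sets.Basic CollectI exI[of _ "g -` A \<inter> space T"] conjI)
  qed
  show "indep_set (sigma_sets (space M) {X -` A \<inter> space M |A. A \<in> sets S})
     (sigma_sets (space M) {(\<lambda>s. g (Z s)) -` A \<inter> space M |A. A \<in> sets T'})"
    using indep unfolding indep_set_def sets_vimage_algebra[of _ X]
    by (rule indep_sets_mono_sets) (use sub in \<open>auto split: bool.split\<close>)
qed

text \<open>Projecting onto a nonzero \<open>w\<close> gives a real model with scale
  \<open>\<sigma>\<close> and noise \<open>eps s \<bullet> w\<close>, to which
  \<open>local_frechet_weak_conv\<close> applies with \<open>c0 = m x \<bullet> w\<close> and the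
  slope of the projected regression function. The second claim is the direction
  \<open>w = m x\<close>.\<close>

theorem theorem1:
  fixes P :: "'b measure" and M :: "'c measure"
    and X :: "'b \<Rightarrow> real" and Y eps :: "'b \<Rightarrow> 'a::{real_inner, complete_space}"
    and m :: "real \<Rightarrow> 'a" and \<sigma> :: "real \<Rightarrow> real"
    and Xs :: "nat \<Rightarrow> 'c \<Rightarrow> real" and Ys :: "nat \<Rightarrow> 'c \<Rightarrow> 'a"
    and f K :: "real \<Rightarrow> real" and h :: "nat \<Rightarrow> real"
    and x :: real and N :: "real set"
  assumes P: "prob_space P"
    and X_rv: "X \<in> borel_measurable P"
    and X_mean: "integrable P X"
    and X_sq: "integrable P (\<lambda>s. (X s)\<^sup>2)"
    and X_var: "(LINT s|P. (X s - (LINT t|P. X t))\<^sup>2) > 0"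
    and Y_rv: "Y \<in> borel_measurable P"
    and Y_sq: "integrable P (\<lambda>s. (norm (Y s))\<^sup>2)"
    and eps_rv: "eps \<in> borel_measurable P"
    and eps_indep: "prob_space.indep_set P (sets (vimage_algebra (space P) X borel))
                                           (sets (vimage_algebra (space P) eps borel))"
    and eps_mean: "\<And>w. (LINT s|P. eps s \<bullet> w) = 0"
    and eps_sq: "(LINT s|P. (norm (eps s))\<^sup>2) = 1"
    and model: "\<And>s. s \<in> space P \<Longrightarrow> Y s = m (X s) + \<sigma> (X s) *\<^sub>R eps s"
    and sigma_nonneg: "\<And>t. \<sigma> t \<ge> 0"
    and sigma_sq: "cond_exp_given P X (\<lambda>s. (norm (Y s - m (X s)))\<^sup>2) (\<lambda>t. ennreal ((\<sigma> t)\<^sup>2))"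
    and M: "prob_space M"
    and sample_indep: "prob_space.indep_vars M (\<lambda>_. borel \<Otimes>\<^sub>M borel) (\<lambda>i s. (Xs i s, Ys i s)) UNIV"
    and sample_distr: "\<And>i. distr M (borel \<Otimes>\<^sub>M borel) (\<lambda>s. (Xs i s, Ys i s))
                          = distr P (borel \<Otimes>\<^sub>M borel) (\<lambda>s. (X s, Y s))"
    and N: "open N" "x \<in> N"
    and N1: "\<And>t. f t \<ge> 0" "distributed P lborel X (\<lambda>t. ennreal (f t))"
            "continuous_on N f" "\<And>t. t \<in> N \<Longrightarrow> f t > 0"
    and N2: "\<And>u. K u \<ge> 0" "integrable lborel K" "(LINT u|lborel. K u) = 1"
            "\<And>u. K (- u) = K u" "bounded {u. K u \<noteq> 0}"
            "integrable lborel (\<lambda>u. u\<^sup>2 * K u)" "integrable lborel (\<lambda>u. (K u)\<^sup>2)"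
    and N3: "\<And>n. h n > 0" "h \<longlonglongrightarrow> 0" "filterlim (\<lambda>n. real n * h n) at_top sequentially"
            "(\<lambda>n. real n * h n ^ 5) \<longlonglongrightarrow> 0"
    and O1: "\<And>w. (\<lambda>t. m t \<bullet> w) C1_differentiable_on N"
            "\<And>w. deriv (\<lambda>t. m t \<bullet> w) C1_differentiable_on N"
    and O2: "\<And>w. w \<noteq> 0 \<Longrightarrow> continuous_on N (\<lambda>t. (\<sigma> t)\<^sup>2 * (LINT s|P. (eps s \<bullet> w)\<^sup>2))"
            "\<And>w t. w \<noteq> 0 \<Longrightarrow> t \<in> N \<Longrightarrow> (\<sigma> t)\<^sup>2 * (LINT s|P. (eps s \<bullet> w)\<^sup>2) > 0"
    and O3: "\<And>w. \<exists>g. cond_exp_given P X (\<lambda>s. (Y s \<bullet> w) ^ 4) g \<and>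
                     (\<exists>B::real. \<forall>t\<in>N. g t \<le> ennreal B)"
  shows
    "(\<forall>w. weak_conv_m
        (\<lambda>n. distr M borel (\<lambda>s.
           sqrt (real n * h n) *
             ((local_frechet K (h n) x n (\<lambda>i. Xs i s) (\<lambda>i. Ys i s) - m x) \<bullet> w
              - ((LINT u|lborel. u\<^sup>2 * K u) / 2 * deriv (deriv (\<lambda>t. m t \<bullet> w)) x) * (h n)\<^sup>2)))
        (normal_law 0
           ((LINT u|lborel. (K u)\<^sup>2) / f x * (\<sigma> x)\<^sup>2 * (LINT s|P. (eps s \<bullet> w)\<^sup>2))))
     \<and> weak_conv_m
        (\<lambda>n. distr M borel (\<lambda>s.
           sqrt (real n * h n) *
             (local_frechet K (h n) x n (\<lambda>i. Xs i s) (\<lambda>i. Ys i s) \<bullet> m x - (norm (m x))\<^sup>2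
              - ((LINT u|lborel. u\<^sup>2 * K u) / 2 * deriv (deriv (\<lambda>t. m t \<bullet> m x)) x) * (h n)\<^sup>2)))
        (normal_law 0
           ((LINT u|lborel. (K u)\<^sup>2) / f x * (\<sigma> x)\<^sup>2 * (LINT s|P. (eps s \<bullet> m x)\<^sup>2)))"
proof -
  interpret P: prob_space P by (rule P)
  interpret M: prob_space M by (rule M)
  have K: "kernel_like K" and K2: "kernel_like (\<lambda>u. (K u)\<^sup>2)"
    using N2 by (simp_all add: kernel_like_def)
  have N_meas [measurable]: "N \<in> sets borel" using N(1) by simp
  \<comment> \<open>Measurability of \<open>\<sigma>\<close> is extracted from the conditional
    variance: \<open>(\<sigma> t)\<^sup>2\<close> is measurable as a version of a conditional
    expectation, and \<open>\<sigma>\<close> is its nonnegative root.\<close>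
  have "(\<lambda>t. ennreal ((\<sigma> t)\<^sup>2)) \<in> borel_measurable borel"
    using sigma_sq by (simp add: cond_exp_given_def)
  from measurable_compose[OF this, of "\<lambda>e. sqrt (enn2real e)" borel]
  have "(\<lambda>t. sqrt (enn2real (ennreal ((\<sigma> t)\<^sup>2)))) \<in> borel_measurable borel"
    by measurable
  moreover have "sqrt (enn2real (ennreal ((\<sigma> t)\<^sup>2))) = \<sigma> t" for t
    by (subst enn2real_ennreal) (use sigma_nonneg in auto)
  ultimately have \<sigma>_meas [measurable]: "\<sigma> \<in> borel_measurable borel"
    by (simp only:)
  have inner_meas: "(\<lambda>y. y \<bullet> w) \<in> borel_measurable borel" for w :: 'a
    by (intro borel_measurable_continuous_onI continuous_intros)
  have sample_meas: "(\<lambda>s. (Xs i s, Ys i s)) \<in> M \<rightarrow>\<^sub>M borel \<Otimes>\<^sub>M borel" for i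
    using sample_indep by (auto simp: M.indep_vars_def)
  have Ys_meas: "Ys i \<in> borel_measurable M" for i
    using measurable_compose[OF sample_meas[of i] measurable_snd] by simp
  \<comment> \<open>A non-integrable function has integral 0 by convention, whereas this integral is
    1.\<close>
  have eps_sq_int: "integrable P (\<lambda>s. (norm (eps s))\<^sup>2)"
    using eps_sq not_integrable_integral_eq by fastforce
  have main: "weak_conv_m
        (\<lambda>n. distr M borel (\<lambda>s.
           sqrt (real n * h n) *
             ((local_frechet K (h n) x n (\<lambda>i. Xs i s) (\<lambda>i. Ys i s) - m x) \<bullet> w
              - ((LINT u|lborel. u\<^sup>2 * K u) / 2 * deriv (deriv (\<lambda>t. m t \<bullet> w)) x) * (h n)\<^sup>2)))
        (normal_law 0
           ((LINT u|lborel. (K u)\<^sup>2) / f x * (\<sigma> x)\<^sup>2 * (LINT s|P. (eps s \<bullet> w)\<^sup>2)))" for w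
  proof (cases "w = 0")
    \<comment> \<open>In the zero direction the statistic is constantly 0 and the variance is 0, so
      both laws are the point mass at 0; (O2) concerns nonzero directions.\<close>
    case True
    then show ?thesis
      by (simp add: normal_law_def weak_conv_m_def weak_conv_def)
  next
    case False
    define \<eta> where "\<eta> s = eps s \<bullet> w" for s
    \<comment> \<open>The cut-off by \<open>N\<close> reflects that \<open>m t \<bullet> w\<close>
      is known to be continuous, hence measurable, only there. Near \<open>x\<close> nothing
      changes: \<open>g\<close> recovers the projected error from a data point.\<close>
    define \<tau> where "\<tau> t = indicator N t * \<sigma> t" for t
    define g where "g t y = indicator N t * (y \<bullet> w) - indicator N t *\<^sub>R (m t \<bullet> w)" for t y
    define Gs where "Gs i s = g (Xs i s) (Ys i s)" for i s
    define q where "q = (LINT s|P. (eps s \<bullet> w)\<^sup>2)"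
    have q: "q > 0"
      using O2(2)[OF False N(2)] unfolding q_def[symmetric]
      by (metis zero_less_mult_pos zero_le_power2 less_eq_real_def mult_zero_left order_less_irrefl)
    have \<eta>_sq: "integrable P (\<lambda>s. (\<eta> s)\<^sup>2)"
    proof (rule Bochner_Integration.integrable_bound)
      show "integrable P (\<lambda>s. (norm (eps s))\<^sup>2 * (norm w)\<^sup>2)"
        using eps_sq_int by simp
      show "(\<lambda>s. (\<eta> s)\<^sup>2) \<in> borel_measurable P"
        unfolding \<eta>_def using measurable_compose[OF eps_rv inner_meas] by measurable
      have "(eps s \<bullet> w)\<^sup>2 \<le> (norm (eps s) * norm w)\<^sup>2" for s
        using Cauchy_Schwarz_ineq2[of "eps s" w] by (simp add: abs_le_square_iff[symmetric])
      then show "AE s in P. norm ((\<eta> s)\<^sup>2) \<le> norm ((norm (eps s))\<^sup>2 * (norm w)\<^sup>2)"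
        by (simp add: \<eta>_def power_mult_distrib)
    qed
    have f_cont: "isCont f x"
      using N1(3) N by (simp add: continuous_on_eq_continuous_at)
    \<comment> \<open>\<open>\<sigma>\<close> is recovered from the continuous function
      \<open>(\<sigma> t)\<^sup>2 * q\<close> by dividing by \<open>q > 0\<close> and taking the
      nonnegative root.\<close>
    have \<tau>_cont: "isCont \<tau> x"
    proof -
      have "isCont (\<lambda>t. (\<sigma> t)\<^sup>2 * q) x"
        using O2(1)[OF False] N by (simp add: continuous_on_eq_continuous_at q_def)
      then have "isCont (\<lambda>t. sqrt ((\<sigma> t)\<^sup>2 * q * (1 / q))) x"
        by (rule continuous_real_sqrt[OF continuous_mult[OF _ continuous_const]])
      moreover have "sqrt ((\<sigma> t)\<^sup>2 * q * (1 / q)) = \<sigma> t" for t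
        using q sigma_nonneg by simp
      ultimately have "isCont \<sigma> x"
        by (simp only:)
      moreover have "\<forall>\<^sub>F t in nhds x. \<tau> t = \<sigma> t"
        using eventually_nhds_in_open[OF N] by eventually_elim (simp add: \<tau>_def)
      ultimately show ?thesis using isCont_cong by blast
    qed
    have indep: "P.indep_var borel X borel \<eta>"
      unfolding \<eta>_def by (rule P.indep_var_compose_vimage_algebra[OF eps_indep X_rv eps_rv inner_meas])
    have g_meas: "case_prod g \<in> borel_measurable (borel \<Otimes>\<^sub>M borel)"
    proof -
      have [measurable]: "(\<lambda>t. indicator N t *\<^sub>R (m t \<bullet> w)) \<in> borel_measurable borel"
        using C1_differentiable_imp_continuous_on[OF O1(1)[of w]]
        by (intro borel_measurable_continuous_on_indicator) auto
      have [measurable]: "(\<lambda>y. y \<bullet> w) \<in> borel_measurable borel" by (rule inner_meas)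
      show ?thesis unfolding g_def by measurable
    qed
    then have pair_meas: "(\<lambda>(t, y). (t, g t y)) \<in> borel \<Otimes>\<^sub>M borel \<rightarrow>\<^sub>M borel \<Otimes>\<^sub>M borel"
      by measurable
    have g_model: "g (X s) (Y s) = \<tau> (X s) * \<eta> s" if "s \<in> space P" for s
      by (simp add: g_def \<tau>_def \<eta>_def model[OF that] inner_add_left algebra_simps)
    interpret L: local_sample M P X \<eta> f \<tau> x Xs Gs h
    proof
      show "distributed P lborel X (\<lambda>t. ennreal (f t))" by (rule N1(2))
      show "isCont f x" by (rule f_cont)
      show "isCont \<tau> x" by (rule \<tau>_cont)
      show "\<tau> \<in> borel_measurable borel" unfolding \<tau>_def by measurable
      show "P.indep_var borel X borel \<eta>" by (rule indep)
      show "(LINT s|P. \<eta> s) = 0" by (simp add: \<eta>_def eps_mean)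
      show "M.indep_vars (\<lambda>_. borel \<Otimes>\<^sub>M borel) (\<lambda>i s. (Xs i s, Gs i s)) UNIV"
        using M.indep_vars_compose2[OF sample_indep pair_meas] by (simp add: Gs_def)
      \<comment> \<open>The model equation holds pointwise on \<open>P\<close> only. The common law
        of the data is therefore pushed forward by \<open>(t, y) \<mapsto> (t, g t y)\<close>, and
        the equation is inserted on the side of \<open>P\<close>.\<close>
      show "distr M (borel \<Otimes>\<^sub>M borel) (\<lambda>s. (Xs i s, Gs i s)) =
          distr P (borel \<Otimes>\<^sub>M borel) (\<lambda>s. (X s, \<tau> (X s) * \<eta> s))" for i
      proof -
        have XY: "(\<lambda>s. (X s, Y s)) \<in> P \<rightarrow>\<^sub>M borel \<Otimes>\<^sub>M borel"
          using X_rv Y_rv by measurable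
        have "distr M (borel \<Otimes>\<^sub>M borel) (\<lambda>s. (Xs i s, Gs i s)) =
            distr (distr M (borel \<Otimes>\<^sub>M borel) (\<lambda>s. (Xs i s, Ys i s))) (borel \<Otimes>\<^sub>M borel) (\<lambda>(t, y). (t, g t y))"
          by (simp add: distr_distr[OF pair_meas sample_meas] comp_def Gs_def)
        also have "\<dots> = distr P (borel \<Otimes>\<^sub>M borel) (\<lambda>s. (X s, g (X s) (Y s)))"
          unfolding sample_distr by (simp add: distr_distr[OF pair_meas XY] comp_def)
        also have "\<dots> = distr P (borel \<Otimes>\<^sub>M borel) (\<lambda>s. (X s, \<tau> (X s) * \<eta> s))"
          by (rule distr_cong) (simp_all add: g_model)
        finally show ?thesis .
      qed
    qed (use N1 N3 \<eta>_sq in auto)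
    obtain d B where d: "d > 0" and taylor: "\<And>t. \<bar>t - x\<bar> \<le> d \<Longrightarrow>
        t \<in> N \<and> \<bar>m t \<bullet> w - m x \<bullet> w - deriv (\<lambda>t. m t \<bullet> w) x * (t - x)\<bar> \<le> B * (t - x)\<^sup>2"
      using taylor_quadratic_bound[OF N O1(1)[of w] O1(2)[of w]] by blast
    \<comment> \<open>For large \<open>n\<close> the kernel only sees points within \<open>d\<close>
      of \<open>x\<close>, hence in \<open>N\<close>. There \<open>Gs i\<close> removes the noise
      completely, and what remains is the deterministic Taylor remainder.\<close>
    have remainder: "\<forall>\<^sub>F n in sequentially. \<forall>i s. K ((Xs i s - x) / h n) \<noteq> 0 \<longrightarrow>
      \<bar>Ys i s \<bullet> w - m x \<bullet> w - deriv (\<lambda>t. m t \<bullet> w) x * (Xs i s - x) - Gs i s\<bar> \<le> B * (Xs i s - x)\<^sup>2"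
      using eventually_kernel_support_near[OF K N3(1,2) d, of x]
    proof eventually_elim
      case (elim n)
      show ?case
      proof (intro allI impI)
        fix i s assume "K ((Xs i s - x) / h n) \<noteq> 0"
        with elim have t: "\<bar>Xs i s - x\<bar> \<le> d" by blast
        then have "Gs i s = Ys i s \<bullet> w - m (Xs i s) \<bullet> w"
          using taylor by (simp add: Gs_def g_def)
        then have "Ys i s \<bullet> w - m x \<bullet> w - deriv (\<lambda>t. m t \<bullet> w) x * (Xs i s - x) - Gs i s =
            m (Xs i s) \<bullet> w - m x \<bullet> w - deriv (\<lambda>t. m t \<bullet> w) x * (Xs i s - x)"
          by simp
        then show "\<bar>Ys i s \<bullet> w - m x \<bullet> w - deriv (\<lambda>t. m t \<bullet> w) x * (Xs i s - x) - Gs i s\<bar>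
            \<le> B * (Xs i s - x)\<^sup>2"
          using taylor[OF t] by (simp only:)
      qed
    qed
    have "\<tau> x = \<sigma> x" "L.noise_var = (LINT s|P. (eps s \<bullet> w)\<^sup>2)"
      using N by (simp_all add: \<tau>_def L.noise_var_def \<eta>_def)
    then show ?thesis
      using L.local_frechet_weak_conv[OF Ys_meas N1(4)[OF N(2)] N2(1) K K2 N2(3,4) N3(4) remainder]
      by (simp only: inner_diff_left)
  qed
  have "(local_frechet K (h n) x n (\<lambda>i. Xs i s) (\<lambda>i. Ys i s) - m x) \<bullet> m x =
      local_frechet K (h n) x n (\<lambda>i. Xs i s) (\<lambda>i. Ys i s) \<bullet> m x - (norm (m x))\<^sup>2" for n s
    by (simp add: inner_diff_left power2_norm_eq_inner)
  then show ?thesis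
    using main main[of "m x"] by simp
qed

end
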